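(* Let $d\ge2$ be an integer. The set $\mathcal{F}=\{f\in\mathrm{Homeo}([0,1]^d): f\text{ is strongly singular}\}$ is Haar ambivalent in $\mathrm{Homeo}([0,1]^d)$. In fact, both $\mathcal{F}$ and its complement $\mathcal{F}^c=\mathrm{Homeo}([0,1]^d)\setminus\mathcal{F}$ are compact catcher.
   Context: $\mathrm{Homeo}([0,1]^d)$ is the group (under composition) of homeomorphisms of $[0,1]^d$ with the topology of the maximum metric $\max_x|f(x)-g(x)|$; it is a Polish group. A homeomorphism $f\in\mathrm{Homeo}([0,1]^d)$ is strongly singular if for Lebesgue almost every $x\in[0,1]^d$, $f$ is differentiable at $x$ and $\det f'(x)=0$. A subset $X$ of a Polish group $G$ is Haar null if there exist a Borel probability measure $\mu$ on $G$ and a Borel set $B\supseteq X$ such that $\mu(gBh)=0$ for all $g,h\in G$; a set is prevalent if its complement is Haar null; a set is Haar ambivalent if it is neither Haar null nor prevalent. A set $A\subseteq G$ is compact catcher if for every compact $K\subseteq G$ there exist $g,h\in G$ with $gKh\subseteq A$. *)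

theory Defs
  imports
    "HOL-Analysis.Analysis"
    "HOL-Probability.Probability_Measure"
    "HOL-Algebra.Bij"
    "HOL-Algebra.Coset"
begin

section \<open>Haar null sets and compact catchers\<close>

text \<open>
  A topological group is given by a group \<open>G\<close> together with a topology \<open>T\<close> on its carrier;
  the notions below are meant for Polish groups.
  The two-sided translate of a set \<open>B\<close> is written with the library cosets,
  \<open>(g <#\<^bsub>G\<^esub> B) #>\<^bsub>G\<^esub> h = {g b h | b \<in> B}\<close>.
\<close>

definition borel_of :: "'a topology \<Rightarrow> 'a measure" where
  "borel_of T = sigma (topspace T) {U. openin T U}"

definition haar_null :: "('a, 'b) monoid_scheme \<Rightarrow> 'a topology \<Rightarrow> 'a set \<Rightarrow> bool" where
  "haar_null G T X \<longleftrightarrow> X \<subseteq> carrier G \<and>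
     (\<exists>\<mu> B. sets \<mu> = sets (borel_of T) \<and> prob_space \<mu> \<and>
            B \<in> sets (borel_of T) \<and> X \<subseteq> B \<and>
            (\<forall>g\<in>carrier G. \<forall>h\<in>carrier G. (g <#\<^bsub>G\<^esub> B) #>\<^bsub>G\<^esub> h \<in> null_sets \<mu>))"

definition prevalent :: "('a, 'b) monoid_scheme \<Rightarrow> 'a topology \<Rightarrow> 'a set \<Rightarrow> bool" where
  "prevalent G T X \<longleftrightarrow> X \<subseteq> carrier G \<and> haar_null G T (carrier G - X)"

definition haar_ambivalent :: "('a, 'b) monoid_scheme \<Rightarrow> 'a topology \<Rightarrow> 'a set \<Rightarrow> bool" where
  "haar_ambivalent G T X \<longleftrightarrow> X \<subseteq> carrier G \<and> \<not> haar_null G T X \<and> \<not> prevalent G T X"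

definition compact_catcher :: "('a, 'b) monoid_scheme \<Rightarrow> 'a topology \<Rightarrow> 'a set \<Rightarrow> bool" where
  "compact_catcher G T A \<longleftrightarrow> A \<subseteq> carrier G \<and>
     (\<forall>K. compactin T K \<longrightarrow>
       (\<exists>g\<in>carrier G. \<exists>h\<in>carrier G. (g <#\<^bsub>G\<^esub> K) #>\<^bsub>G\<^esub> h \<subseteq> A))"

section \<open>Homeomorphism groups\<close>

text \<open>
  Self-homeomorphisms of \<open>S\<close> are represented by functions that are \<open>undefined\<close> outside \<open>S\<close>,
  so that equality of functions is equality on \<open>S\<close>. The group operation is composition,
  inherited from the group of all bijections of \<open>S\<close>.
\<close>

definition Homeo :: "'a::topological_space set \<Rightarrow> ('a \<Rightarrow> 'a) monoid" where
  "Homeo S = (BijGroup S) \<lparr>carrier := {f \<in> extensional S. \<exists>g. homeomorphism S S f g}\<rparr>"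

lemma carrier_Homeo: "f \<in> carrier (Homeo S) \<longleftrightarrow> f \<in> extensional S \<and> (\<exists>g. homeomorphism S S f g)"
  by (simp add: Homeo_def)

lemma subgroup_Homeo: "subgroup (carrier (Homeo S)) (BijGroup S)"
proof
  have bij: "f \<in> Bij S" if "f \<in> carrier (Homeo S)" for f
    using that unfolding carrier_Homeo Bij_def homeomorphism_def
    by (auto intro!: bij_betwI') metis+
  then show "carrier (Homeo S) \<subseteq> carrier (BijGroup S)"
    by (auto simp: BijGroup_def)
  show "x \<otimes>\<^bsub>BijGroup S\<^esub> y \<in> carrier (Homeo S)"
    if x: "x \<in> carrier (Homeo S)" and y: "y \<in> carrier (Homeo S)" for x y
  proof -
    obtain x' y' where "homeomorphism S S x x'" "homeomorphism S S y y'"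
      using x y by (auto simp: carrier_Homeo)
    then have "homeomorphism S S (x \<circ> y) (y' \<circ> x')"
      by (rule homeomorphism_compose[rotated])
    then have "homeomorphism S S (compose S x y) (y' \<circ> x')"
      by (rule homeomorphism_cong) (auto simp: compose_def)
    then show ?thesis
      using bij[OF x] bij[OF y] by (auto simp: BijGroup_def carrier_Homeo)
  qed
  have "homeomorphism S S (\<lambda>x\<in>S. x) (\<lambda>x. x)"
    by (rule homeomorphism_cong[OF homeomorphism_ident]) auto
  then show "\<one>\<^bsub>BijGroup S\<^esub> \<in> carrier (Homeo S)"
    by (auto simp: BijGroup_def carrier_Homeo)
  show "inv\<^bsub>BijGroup S\<^esub> x \<in> carrier (Homeo S)" if x: "x \<in> carrier (Homeo S)" for x
  proof -
    obtain x' where h: "homeomorphism S S x x'"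
      using x by (auto simp: carrier_Homeo)
    have "inv_into S x a = x' a" if "a \<in> S" for a
      using bij[OF x] h that unfolding Bij_def homeomorphism_def
      by (metis IntD2 bij_betw_def imageI inv_into_f_eq mem_Collect_eq)
    then have "homeomorphism S S (restrict (inv_into S x) S) x"
      using h by (intro homeomorphism_cong[OF homeomorphism_symD[OF h]]) auto
    then show ?thesis
      using inv_BijGroup[OF bij[OF x]] by (auto simp: carrier_Homeo)
  qed
qed

lemma group_Homeo: "group (Homeo S)"
  using subgroup.subgroup_is_group[OF subgroup_Homeo group_BijGroup, of S]
  by (simp add: Homeo_def)

text \<open>
  The library metric \<open>funspace\<close> on bounded extensional functions is the supremum metric; for
  compact nonempty \<open>S\<close> the supremum over \<open>S\<close> is a maximum.
\<close>

definition homeo_metric :: "'a::metric_space set \<Rightarrow> ('a \<Rightarrow> 'a) metric" where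
  "homeo_metric S = submetric (funspace S euclidean_metric) (carrier (Homeo S))"

definition homeo_topology :: "'a::metric_space set \<Rightarrow> ('a \<Rightarrow> 'a) topology" where
  "homeo_topology S = mtopology_of (homeo_metric S)"

lemma Homeo_subset_fspace:
  fixes S :: "'a::metric_space set"
  assumes "compact S"
  shows "carrier (Homeo S) \<subseteq> Met_TC.fspace S"
  using compact_imp_bounded[OF assms]
  by (auto simp: carrier_Homeo homeomorphism_def Met_TC.fspace_def)

lemma mspace_homeo_metric: "compact S \<Longrightarrow> mspace (homeo_metric S) = carrier (Homeo S)"
  using Homeo_subset_fspace[of S] by (auto simp: homeo_metric_def)

lemma mdist_homeo_metric:
  assumes "compact S" "S \<noteq> {}" "f \<in> carrier (Homeo S)" "g \<in> carrier (Homeo S)"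
  shows "mdist (homeo_metric S) f g = (SUP x\<in>S. dist (f x) (g x))"
  using Homeo_subset_fspace[OF assms(1)] assms
  by (auto simp: homeo_metric_def Met_TC.fdist_def)

lemma topspace_homeo_topology: "compact S \<Longrightarrow> topspace (homeo_topology S) = carrier (Homeo S)"
  by (simp add: homeo_topology_def mspace_homeo_metric)

section \<open>Strongly singular homeomorphisms of the cube\<close>

definition unit_cube :: "(real ^ 'n) set" where
  "unit_cube = {x. \<forall>i. 0 \<le> x $ i \<and> x $ i \<le> 1}"

text \<open>
  Since \<open>f\<close> only matters on the cube, the derivative is taken within the cube. At interior
  points this is the usual derivative, and the boundary is a null set.
\<close>

definition strongly_singular :: "(real ^ 'n \<Rightarrow> real ^ 'n) \<Rightarrow> bool" where
  "strongly_singular f \<longleftrightarrow>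
     (AE x in lebesgue_on unit_cube.
        f differentiable (at x within unit_cube) \<and>
        det (jacobian f (at x within unit_cube)) = 0)"

end

theory Submission
  imports Defs
begin

text \<open>
  If \<open>K\<close> is equicontinuous and \<open>h\<close> is a homeomorphism that is, at almost every point, flatter than
  the common modulus of continuity can undo, then every \<open>k \<circ> h\<close> with \<open>k \<in> K\<close> has derivative \<open>0\<close>
  almost everywhere. One can take \<open>h\<close> to act on each coordinate by an increasing homeomorphism: a
  superposition of staircases located at all rationals, of size shrinking rapidly relative to
  their width.

  Dually, if the inverses of \<open>K\<close> are equicontinuous and \<open>g\<close> oscillates near every interior point
  by more than their modulus permits for a differentiable function, then no \<open>g \<circ> k\<close> is
  differentiable at any interior point. In dimension at least two such a \<open>g\<close> is the shear
  \<open>(s,t) \<mapsto> (s, t + w(s) t (1 - t))\<close> along a very rough function \<open>w\<close>.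

  Compact sets are equicontinuous together with their inverses, and every Borel probability measure
  gives positive mass to some set of this kind, so being caught excludes being Haar null.
\<close>

section \<open>A devil's staircase\<close>

text \<open>Iterates of the operator whose fixed point is the Cantor function, started at the
  identity clamped to [0,1]. Every iterate is 0 left of 0 and 1 right of 1, so adding two rescaled
  copies replaces the usual case split into thirds.\<close>

primrec cantor_approx :: "nat \<Rightarrow> real \<Rightarrow> real" where
  "cantor_approx 0 x = max 0 (min 1 x)"
| "cantor_approx (Suc n) x = (cantor_approx n (3 * x) + cantor_approx n (3 * x - 2)) / 2"

lemma cantor_approx_le_0: "x \<le> 0 \<Longrightarrow> cantor_approx n x = 0"
  by (induction n arbitrary: x) auto

lemma cantor_approx_ge_1: "x \<ge> 1 \<Longrightarrow> cantor_approx n x = 1"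
  by (induction n arbitrary: x) auto

lemma continuous_on_cantor_approx: "continuous_on UNIV (cantor_approx n)"
proof (induction n)
  case (Suc n)
  have "continuous_on UNIV (\<lambda>x. cantor_approx n (a * x - b))" for a b
    by (rule continuous_on_compose2[OF Suc]) (auto intro!: continuous_intros)
  from this[of 3 0] this[of 3 2] show ?case
    by (auto intro!: continuous_intros)
qed (auto intro!: continuous_intros)

lemma mono_cantor_approx: "mono (cantor_approx n)"
proof (induction n)
  case (Suc n)
  show ?case
    by (rule monoI) (auto intro!: divide_right_mono add_mono monoD[OF Suc])
qed (auto simp: mono_def)

text \<open>The points \<open>3 * x\<close> and \<open>3 * x - 2\<close> never both lie in (0,1), so
  at most one of the two copies contributes to the difference of successive iterates, and the factor
  1/2 makes the difference decay geometrically.\<close>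

lemma cantor_approx_step: "\<bar>cantor_approx (Suc n) x - cantor_approx n x\<bar> \<le> (1/2) ^ n"
proof (induction n arbitrary: x)
  case 0
  show ?case by (auto simp: max_def min_def abs_if field_simps)
next
  case (Suc n)
  define D where "D y = cantor_approx (Suc n) y - cantor_approx n y" for y
  have "D y = 0" if "y \<le> 0 \<or> y \<ge> 1" for y
    using that cantor_approx_le_0 cantor_approx_ge_1 unfolding D_def by (metis diff_self)
  then have "D (3 * x) = 0 \<or> D (3 * x - 2) = 0"
    by (cases "x \<le> 1/2") auto
  moreover have "\<bar>D y\<bar> \<le> (1/2) ^ n" for y
    using Suc[of y] by (simp add: D_def)
  ultimately have "\<bar>D (3 * x) + D (3 * x - 2)\<bar> \<le> (1/2) ^ n"
    by fastforce
  moreover have "cantor_approx (Suc (Suc n)) x - cantor_approx (Suc n) x = (D (3 * x) + D (3 * x - 2)) / 2"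
    by (simp add: D_def field_simps)
  ultimately show ?case
    by (simp only: abs_divide power_Suc) simp
qed

definition cantor :: "real \<Rightarrow> real" where
  "cantor x = lim (\<lambda>n. cantor_approx n x)"

lemma uniform_limit_cantor: "uniform_limit UNIV cantor_approx cantor sequentially"
proof -
  have tele: "(\<Sum>i<n. cantor_approx (Suc i) x - cantor_approx i x) + cantor_approx 0 x = cantor_approx n x" for n x
    using sum_lessThan_telescope[of "\<lambda>i. cantor_approx i x" n] by linarith
  have "uniformly_convergent_on UNIV
      (\<lambda>n x. \<Sum>i<n. cantor_approx (Suc i) x - cantor_approx i x)"
    by (rule Weierstrass_m_test'[where M = "\<lambda>n. (1/2) ^ n"])
       (use cantor_approx_step in \<open>auto intro: summable_geometric\<close>)
  then obtain l where l: "uniform_limit UNIV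
      (\<lambda>n x. \<Sum>i<n. cantor_approx (Suc i) x - cantor_approx i x) l sequentially"
    by (auto simp: uniformly_convergent_on_def)
  have "uniform_limit UNIV
      (\<lambda>n x. (\<Sum>i<n. cantor_approx (Suc i) x - cantor_approx i x) + cantor_approx 0 x)
      (\<lambda>x. l x + cantor_approx 0 x) sequentially"
    using l by (intro uniform_limit_intros)
  then have u: "uniform_limit UNIV cantor_approx (\<lambda>x. l x + cantor_approx 0 x) sequentially"
    unfolding tele .
  have "cantor = (\<lambda>x. l x + cantor_approx 0 x)"
    unfolding cantor_def using tendsto_uniform_limitI[OF u] by (auto intro!: limI)
  with u show ?thesis by simp
qed

lemma cantor_approx_tendsto: "(\<lambda>n. cantor_approx n x) \<longlonglongrightarrow> cantor x"
  using tendsto_uniform_limitI[OF uniform_limit_cantor] by simp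

lemma continuous_on_cantor: "continuous_on UNIV cantor"
  by (rule uniform_limit_theorem[OF _ uniform_limit_cantor])
     (auto simp: continuous_on_cantor_approx)

lemma mono_cantor: "mono cantor"
  by (rule monoI, rule LIMSEQ_le[OF cantor_approx_tendsto cantor_approx_tendsto])
     (auto intro: monoD[OF mono_cantor_approx])

lemma cantor_le_0 [simp]: "x \<le> 0 \<Longrightarrow> cantor x = 0"
  by (simp add: cantor_def cantor_approx_le_0)

lemma cantor_ge_1 [simp]: "x \<ge> 1 \<Longrightarrow> cantor x = 1"
  by (simp add: cantor_def cantor_approx_ge_1)

lemma cantor_bounds: "0 \<le> cantor x" "cantor x \<le> 1"
  using monoD[OF mono_cantor, of "min x 0" x] monoD[OF mono_cantor, of x "max x 1"] by auto

lemma cantor_rec: "cantor x = (cantor (3 * x) + cantor (3 * x - 2)) / 2"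
proof (rule LIMSEQ_unique)
  show "(\<lambda>n. cantor_approx (Suc n) x) \<longlonglongrightarrow> cantor x"
    by (rule LIMSEQ_Suc[OF cantor_approx_tendsto])
  show "(\<lambda>n. cantor_approx (Suc n) x) \<longlonglongrightarrow> (cantor (3 * x) + cantor (3 * x - 2)) / 2"
    unfolding cantor_approx.simps by (intro tendsto_intros cantor_approx_tendsto) simp
qed

section \<open>The null set on which the staircase grows\<close>

definition cantor_growth :: "real set" where
  "cantor_growth = {x. \<not> (\<forall>\<^sub>F y in nhds x. cantor y = cantor x)}"

lemma closed_cantor_growth: "closed cantor_growth"
proof -
  have "open {x. \<forall>\<^sub>F y in nhds x. cantor y = cantor x}"
  proof (subst open_subopen, safe)
    fix x assume "\<forall>\<^sub>F y in nhds x. cantor y = cantor x"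
    then obtain U where U: "open U" "x \<in> U" "\<And>y. y \<in> U \<Longrightarrow> cantor y = cantor x"
      by (auto simp: eventually_nhds)
    moreover have "U \<subseteq> {x. \<forall>\<^sub>F y in nhds x. cantor y = cantor x}"
    proof (rule subsetI, rule CollectI)
      fix z assume z: "z \<in> U"
      show "\<forall>\<^sub>F y in nhds z. cantor y = cantor z"
        using eventually_nhds_in_open[OF U(1) z] by eventually_elim (simp add: U(3) z)
    qed
    ultimately show "\<exists>T. open T \<and> x \<in> T \<and> T \<subseteq> {x. \<forall>\<^sub>F y in nhds x. cantor y = cantor x}"
      by blast
  qed
  then show ?thesis
    by (simp add: cantor_growth_def closed_def Collect_neg_eq[symmetric] del: not_eventually)
qed

lemma cantor_growth_subset: "cantor_growth \<subseteq> {0..1}"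
proof -
  have "\<forall>\<^sub>F y in nhds x. cantor y = cantor x" if "x < 0 \<or> x > 1" for x
    using that
  proof
    assume "x < 0"
    then have "\<forall>\<^sub>F y in nhds x. y < 0"
      by (intro eventually_nhds_in_open[of "{..<0}", simplified]) auto
    then show ?thesis
      by eventually_elim (use \<open>x < 0\<close> in auto)
  next
    assume "x > 1"
    then have "\<forall>\<^sub>F y in nhds x. y > 1"
      by (intro eventually_nhds_in_open[of "{1<..}", simplified]) auto
    then show ?thesis
      by eventually_elim (use \<open>x > 1\<close> in auto)
  qed
  then have "\<not> (x < 0 \<or> x > 1)" if "x \<in> cantor_growth" for x
    using that unfolding cantor_growth_def by blast
  then show ?thesis
    by force
qed

text \<open>If \<open>cantor\<close> is locally constant at both \<open>3 * x\<close> and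
  \<open>3 * x - 2\<close>, then by the functional equation \<open>cantor_rec\<close> it is locally
  constant at \<open>x\<close>.\<close>

lemma cantor_growth_self_similar:
  "cantor_growth \<subseteq> (\<lambda>x. (1/3) *\<^sub>R x + 0) ` cantor_growth \<union> (\<lambda>x. (1/3) *\<^sub>R x + 2/3) ` cantor_growth"
proof
  fix x assume x: "x \<in> cantor_growth"
  have "3 * x \<in> cantor_growth \<or> 3 * x - 2 \<in> cantor_growth"
  proof (rule ccontr)
    assume *: "\<not> ?thesis"
    have "\<forall>\<^sub>F y in nhds x. cantor (3 * y - b) = cantor (3 * x - b)" if "3 * x - b \<notin> cantor_growth" for b
    proof -
      have "filterlim (\<lambda>y. 3 * y - b) (nhds (3 * x - b)) (nhds x)"
        by (intro tendsto_intros filterlim_ident)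
      then show ?thesis
        using that by (auto simp: cantor_growth_def filterlim_iff)
    qed
    from this[of 0] this[of 2] *
    have "\<forall>\<^sub>F y in nhds x. cantor (3 * y) = cantor (3 * x)"
      "\<forall>\<^sub>F y in nhds x. cantor (3 * y - 2) = cantor (3 * x - 2)"
      by auto
    then have "\<forall>\<^sub>F y in nhds x. cantor y = cantor x"
      by eventually_elim (metis cantor_rec)
    with x show False by (simp add: cantor_growth_def)
  qed
  then show "x \<in> (\<lambda>x. (1/3) *\<^sub>R x + 0) ` cantor_growth \<union> (\<lambda>x. (1/3) *\<^sub>R x + 2/3) ` cantor_growth"
  proof
    assume "3 * x \<in> cantor_growth"
    then show ?thesis by (intro UnI1 rev_image_eqI[of "3 * x"]) auto
  next
    assume "3 * x - 2 \<in> cantor_growth"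
    then show ?thesis by (intro UnI2 rev_image_eqI[of "3 * x - 2"]) (auto simp: field_simps)
  qed
qed

text \<open>Self-similarity with two copies scaled by 1/3 bounds the measure by 2/3 of itself. The
  set is compact, so this measure is finite and must vanish.\<close>

lemma negligible_cantor_growth: "negligible cantor_growth"
proof -
  have bdd: "bounded cantor_growth"
    by (rule bounded_subset[OF bounded_closed_interval cantor_growth_subset])
  then have m: "cantor_growth \<in> lmeasurable"
    by (intro lmeasurable_compact) (simp add: compact_eq_bounded_closed closed_cantor_growth)
  have *: "(\<lambda>x. (1/3) *\<^sub>R x + b) ` cantor_growth \<in> lmeasurable" for b
    by (rule lmeasurable_compact, rule compact_continuous_image)
       (auto intro!: continuous_intros simp: compact_eq_bounded_closed bdd closed_cantor_growth)
  have "measure lebesgue cantor_growth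
    \<le> measure lebesgue ((\<lambda>x. (1/3) *\<^sub>R x + 0) ` cantor_growth \<union> (\<lambda>x. (1/3) *\<^sub>R x + 2/3) ` cantor_growth)"
    by (intro measure_mono_fmeasurable fmeasurable.Un * fmeasurableD[OF m] cantor_growth_self_similar)
  also have "\<dots> \<le> measure lebesgue ((\<lambda>x. (1/3) *\<^sub>R x + 0) ` cantor_growth)
       + measure lebesgue ((\<lambda>x. (1/3) *\<^sub>R x + 2/3) ` cantor_growth)"
    by (intro measure_Un_le fmeasurableD *)
  also have "\<dots> = 2/3 * measure lebesgue cantor_growth"
    unfolding measure_lebesgue_affine by simp
  finally have "measure lebesgue cantor_growth = 0"
    using measure_nonneg[of lebesgue cantor_growth] by linarith
  with m show ?thesis
    by (simp add: negligible_iff_measure)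
qed

text \<open>Iterating the functional equation while dropping its nonnegative second term gives
  \<open>cantor y\<close> \<ge> 2^-n as soon as y \<ge> 3^-n. Growth immediately to the right of 0
  is what makes the superposition of staircases strictly increasing.\<close>

lemma cantor_pos: "x > 0 \<Longrightarrow> cantor x > 0"
proof -
  assume x: "x > 0"
  have *: "cantor y \<ge> (1/2) ^ n" if "3 ^ n * y \<ge> 1" for n and y :: real
    using that
  proof (induction n arbitrary: y)
    case (Suc n)
    from Suc.prems have "(1/2) ^ n \<le> cantor (3 * y)"
      by (intro Suc.IH) (simp add: algebra_simps)
    then show ?case
      using cantor_rec[of y] cantor_bounds(1)[of "3 * y - 2"] by simp
  qed auto
  obtain n where "1 / x < 3 ^ n"
    using real_arch_pow[of 3 "1/x"] by auto
  then have "3 ^ n * x \<ge> 1"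
    using x by (simp add: field_simps)
  from *[OF this] show "cantor x > 0"
    by (smt (verit) zero_less_power zero_less_divide_1_iff)
qed

section \<open>Superposition of staircases\<close>

text \<open>The k-th summand is a staircase that starts at the k-th rational, has width 2^-k, and
  has its height limited by \<open>\<delta>\<close>. Near almost every point and at scale 2^-n, the
  first summands up to index n are all constant; only the tail moves, and its weights already take
  \<open>\<delta> n\<close> into account.\<close>

lemma exists_flat_increasing_function:
  fixes \<delta> :: "nat \<Rightarrow> real"
  assumes \<delta>: "\<And>n. \<delta> n > 0"
  obtains \<eta> :: "real \<Rightarrow> real" where "continuous_on UNIV \<eta>" "strict_mono \<eta>" "\<eta> 0 = 0" "\<eta> 1 = 1"
    "AE x in lebesgue. \<forall>\<^sub>F n in sequentially. \<forall>y. \<bar>y - x\<bar> \<le> (1/2) ^ n \<longrightarrow> \<bar>\<eta> y - \<eta> x\<bar> < \<delta> n"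
proof -
  define q :: "nat \<Rightarrow> real" where "q k = of_rat (from_nat k)" for k
  \<comment> \<open>Taking the minimum over all indices up to \<open>n\<close> bounds every weight
    \<open>w k\<close> with k \<ge> n by 8^-k times \<open>\<delta> n\<close>.\<close>
  define m where "m n = Min (insert 1 (\<delta> ` {..n}))" for n
  define w where "w n = (1/8) ^ n * m n" for n
  define t where "t k x = w k * cantor (2 ^ k * (x - q k))" for k x
  define S where "S x = (\<Sum>k. t k x)" for x
  have m: "0 < m n" "m n \<le> 1" for n
    using \<delta> by (auto simp: m_def)
  have m_le: "m n \<le> \<delta> k" if "k \<le> n" for k n
    unfolding m_def using that by (intro Min_le) auto
  have w: "0 < w n" "w n \<le> (1/8) ^ n" for n
    using m[of n] by (auto simp: w_def mult_le_cancel_left1)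
  have t: "0 \<le> t k x" "t k x \<le> w k" for k x
    using w[of k] cantor_bounds[of "2 ^ k * (x - q k)"] by (auto simp: t_def mult_le_cancel_left1)
  have t_mono: "t k x \<le> t k y" if "x \<le> y" for k x y
    using that w[of k] by (auto simp: t_def intro!: mult_left_mono monoD[OF mono_cantor])
  have geo: "summable (\<lambda>k. (1/8) ^ k :: real)"
    by simp
  have sum_t: "summable (\<lambda>k. t k x)" for x
    by (rule summable_comparison_test'[OF geo]) (use t w order_trans in fastforce)
  have cont_S: "continuous_on UNIV S"
  proof (rule uniform_limit_theorem)
    have "norm (t k x) \<le> (1/8) ^ k" for k x
      using t[of k x] w[of k] by simp
    then show "uniform_limit UNIV (\<lambda>n x. \<Sum>k<n. t k x) S sequentially"
      unfolding S_def by (intro Weierstrass_m_test[OF _ geo])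
    have "continuous_on UNIV (t k)" for k
      unfolding t_def
      by (intro continuous_intros continuous_on_compose2[OF continuous_on_cantor]) auto
    then show "\<forall>\<^sub>F n in sequentially. continuous_on UNIV (\<lambda>x. \<Sum>k<n. t k x)"
      by (auto intro!: always_eventually continuous_intros simp: eta_contract_eq)
  qed simp
  have S_less: "S x < S y" if xy: "x < y" for x y
  proof -
    \<comment> \<open>The staircase starting at a rational between \<open>x\<close> and
      \<open>y\<close> is 0 at \<open>x\<close> and positive at \<open>y\<close>.\<close>
    obtain r where r: "x < of_rat r" "of_rat r < y"
      using of_rat_dense[OF xy] by blast
    define k where "k = to_nat r"
    have "x < q k" "q k < y"
      using r by (auto simp: q_def k_def)
    then have "t k x < t k y"
      using w[of k] by (auto simp: t_def mult_nonneg_nonpos intro!: mult_pos_pos cantor_pos)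
    then have "0 < (\<Sum>k. t k y - t k x)"
      using xy by (intro suminf_pos2[of _ k] summable_diff sum_t) (auto intro: t_mono)
    then show ?thesis
      by (simp add: S_def suminf_diff[OF sum_t sum_t, symmetric])
  qed
  define c where "c = S 1 - S 0"
  have c: "c > 0"
    using S_less[of 0 1] by (simp add: c_def)
  define \<eta> where "\<eta> x = (S x - S 0) / c" for x
  have "AE x in lebesgue. \<forall>k. 2 ^ k * (x - q k) \<notin> cantor_growth"
    unfolding AE_all_countable
  proof
    fix k
    have "negligible ((\<lambda>x. q k + x) ` (\<lambda>x. x / 2 ^ k) ` cantor_growth)"
      by (intro negligible_translation negligible_differentiable_image_negligible negligible_cantor_growth)
        (auto simp: differentiable_on_def)
    moreover have "{x. \<not> 2 ^ k * (x - q k) \<notin> cantor_growth}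
      \<subseteq> (\<lambda>x. q k + x) ` (\<lambda>x. x / 2 ^ k) ` cantor_growth"
    proof (rule subsetI)
      fix x assume "x \<in> {x. \<not> 2 ^ k * (x - q k) \<notin> cantor_growth}"
      then have "2 ^ k * (x - q k) \<in> cantor_growth"
        by simp
      moreover have "x = q k + (2 ^ k * (x - q k)) / 2 ^ k"
        by simp
      ultimately show "x \<in> (\<lambda>x. q k + x) ` (\<lambda>x. x / 2 ^ k) ` cantor_growth"
        by blast
    qed
    ultimately show "AE x in lebesgue. 2 ^ k * (x - q k) \<notin> cantor_growth"
      unfolding negligible_iff_null_sets by (intro AE_I') auto
  qed
  \<comment> \<open>Borel-Cantelli for the intervals [q k, q k + 2^-k] where the staircases rise,
    enlarged by 2^-k on both sides. The enlargement ensures that the ball of radius 2^-k around a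
    point outside misses the original interval.\<close>
  moreover have "AE x in lebesgue. \<forall>\<^sub>F k in sequentially. x \<in> space lebesgue - {q k - (1/2) ^ k .. q k + 2 * (1/2) ^ k}"
  proof (rule borel_cantelli_AE1)
    show "summable (\<lambda>k. measure lebesgue {q k - (1/2) ^ k .. q k + 2 * (1/2) ^ k})"
      by (rule summable_cong[THEN iffD1, OF _ summable_mult[of "\<lambda>k. (1/2) ^ k" 3]]) auto
  qed (auto simp: emeasure_lborel_Icc_eq)
  ultimately have "AE x in lebesgue. \<forall>\<^sub>F n in sequentially.
      \<forall>y. \<bar>y - x\<bar> \<le> (1/2) ^ n \<longrightarrow> \<bar>\<eta> y - \<eta> x\<bar> < \<delta> n"
  proof eventually_elim
    fix x :: real
    assume growth: "\<forall>k. 2 ^ k * (x - q k) \<notin> cantor_growth"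
      and "\<forall>\<^sub>F k in sequentially. x \<in> space lebesgue - {q k - (1/2) ^ k .. q k + 2 * (1/2) ^ k}"
    then obtain n0 where n0: "\<And>k. k \<ge> n0 \<Longrightarrow> x < q k - (1/2) ^ k \<or> x > q k + 2 * (1/2) ^ k"
      by (fastforce simp: eventually_sequentially)
    have "\<forall>\<^sub>F y in nhds x. t k y = t k x" for k
    proof -
      have "filterlim (\<lambda>y. 2 ^ k * (y - q k)) (nhds (2 ^ k * (x - q k))) (nhds x)"
        by (intro tendsto_intros filterlim_ident)
      moreover have "\<forall>\<^sub>F z in nhds (2 ^ k * (x - q k)). cantor z = cantor (2 ^ k * (x - q k))"
        using growth by (auto simp: cantor_growth_def)
      ultimately show ?thesis
        unfolding t_def filterlim_iff by (auto elim!: eventually_mono)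
    qed
    then have "\<forall>\<^sub>F y in nhds x. \<forall>k\<in>{..<n0}. t k y = t k x"
      by (intro eventually_ball_finite) auto
    then obtain r where r: "r > 0" "\<And>y k. dist y x < r \<Longrightarrow> k < n0 \<Longrightarrow> t k y = t k x"
      unfolding eventually_nhds_metric by auto
    have "\<forall>\<^sub>F n in sequentially. (1/2) ^ n < r"
      using order_tendstoD(2)[OF LIMSEQ_power_zero[of "1/2::real"] \<open>r > 0\<close>] by simp
    moreover have "\<forall>\<^sub>F n in sequentially. (1/8) ^ n < c"
      using order_tendstoD(2)[OF LIMSEQ_power_zero[of "1/8::real"] \<open>c > 0\<close>] by simp
    ultimately show "\<forall>\<^sub>F n in sequentially. \<forall>y. \<bar>y - x\<bar> \<le> (1/2) ^ n \<longrightarrow> \<bar>\<eta> y - \<eta> x\<bar> < \<delta> n"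
      using eventually_ge_at_top[of n0]
    proof (eventually_elim, intro allI impI)
      fix n y
      assume n: "(1/2) ^ n < r" "(1/8) ^ n < c" "n0 \<le> n" and y: "\<bar>y - x\<bar> \<le> (1/2) ^ n"
      \<comment> \<open>Below \<open>n0\<close> the summand is locally constant at \<open>x\<close>.
        From \<open>n0\<close> on, \<open>x\<close> and \<open>y\<close> lie on the same side of the
        interval where it rises.\<close>
      have const: "t k y = t k x" if k: "k < Suc n" for k
      proof (cases "k < n0")
        case True
        then show ?thesis
          using r(2)[of y k] n y by (simp add: dist_real_def)
      next
        case False
        have "(1/2) ^ n \<le> ((1/2) ^ k :: real)"
          using k by (intro power_decreasing) auto
        with y have y': "\<bar>y - x\<bar> \<le> (1/2) ^ k"
          by linarith
        have mul: "2 ^ k * (z - q k) \<ge> 1" if "z \<ge> q k + (1/2) ^ k" for z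
          using that by (simp add: field_simps power_one_over)
        from n0[of k] False y' have "x \<le> q k \<and> y \<le> q k \<or> x \<ge> q k + (1/2) ^ k \<and> y \<ge> q k + (1/2) ^ k"
          using zero_less_power[of "1/2::real" k] by (auto simp: not_less abs_le_iff)
        then show ?thesis
          by (auto simp: t_def mult_nonneg_nonpos mul)
      qed
      have tail: "\<bar>t (k + Suc n) y - t (k + Suc n) x\<bar> \<le> \<delta> n * (1/8) ^ Suc n * (1/8) ^ k" for k
      proof -
        have "\<bar>t (k + Suc n) y - t (k + Suc n) x\<bar> \<le> w (k + Suc n)"
          using t[of "k + Suc n" x] t[of "k + Suc n" y] by linarith
        also have "\<dots> \<le> (1/8) ^ (k + Suc n) * \<delta> n"
          unfolding w_def using m_le[of n "k + Suc n"] by (intro mult_left_mono) auto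
        finally show ?thesis
          by (simp add: power_add mult_ac)
      qed
      have head: "(\<Sum>k<Suc n. t k y - t k x) = 0"
        by (intro sum.neutral ballI) (metis const diff_self lessThan_iff)
      have geo': "summable (\<lambda>k. \<delta> n * (1/8) ^ Suc n * (1/8) ^ k)"
        by (intro summable_mult geo)
      have abs_sum: "summable (\<lambda>k. \<bar>t (k + Suc n) y - t (k + Suc n) x\<bar>)"
        by (rule summable_comparison_test'[OF geo']) (simp only: real_norm_def abs_idempotent tail)
      have "S y - S x = (\<Sum>k. t k y - t k x)"
        by (simp add: S_def suminf_diff[OF sum_t sum_t, symmetric])
      also have "\<dots> = (\<Sum>k. t (k + Suc n) y - t (k + Suc n) x)"
        using suminf_split_initial_segment[OF summable_diff[OF sum_t sum_t], of y x "Suc n"] head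
        by linarith
      also have "\<bar>\<dots>\<bar> \<le> (\<Sum>k. \<bar>t (k + Suc n) y - t (k + Suc n) x\<bar>)"
        by (rule summable_rabs[OF abs_sum])
      also have "\<dots> \<le> (\<Sum>k. \<delta> n * (1/8) ^ Suc n * (1/8) ^ k)"
        by (rule suminf_le[OF tail abs_sum geo'])
      also have "\<dots> = \<delta> n * (1/8) ^ Suc n * (8/7)"
        by (subst suminf_mult[OF geo], subst suminf_geometric) auto
      \<comment> \<open>The sum of the tail bounds is \<open>\<delta> n\<close> * 8^-n / 7, and 8^-n
        < c; the factor \<open>c\<close> is then cancelled by the normalisation of
        \<open>\<eta>\<close>.\<close>
      also have "\<dots> < \<delta> n * c"
        using \<delta>[of n] n c by (simp add: mult_ac)
      finally show "\<bar>\<eta> y - \<eta> x\<bar> < \<delta> n"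
        using c by (simp add: \<eta>_def diff_divide_distrib[symmetric] pos_divide_less_eq)
    qed
  qed
  moreover have "continuous_on UNIV \<eta>"
    unfolding \<eta>_def using c by (intro continuous_intros cont_S) auto
  moreover have "strict_mono \<eta>"
    using S_less c by (auto simp: strict_mono_def \<eta>_def divide_strict_right_mono)
  moreover have "\<eta> 0 = 0" "\<eta> 1 = 1"
    using c by (auto simp: \<eta>_def c_def)
  ultimately show thesis
    using that by blast
qed

section \<open>Equicontinuous families of homeomorphisms\<close>

text \<open>Equicontinuity at tolerance 1/(n+1) for a map together with its inverse, phrased without
  naming the inverse. Strict premises and non-strict conclusions make the set closed under uniform
  limits within the group.\<close>

definition bimodulus :: "'a::metric_space set \<Rightarrow> nat \<Rightarrow> nat \<Rightarrow> ('a \<Rightarrow> 'a) set" where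
  "bimodulus S n m = {f \<in> carrier (Homeo S). \<forall>x\<in>S. \<forall>y\<in>S.
     (dist x y < 1 / Suc m \<longrightarrow> dist (f x) (f y) \<le> 1 / Suc n) \<and>
     (dist (f x) (f y) < 1 / Suc m \<longrightarrow> dist x y \<le> 1 / Suc n)}"

lemma bimodulus_mono: "m \<le> m' \<Longrightarrow> bimodulus S n m \<subseteq> bimodulus S n m'"
proof -
  assume "m \<le> m'"
  then have "1 / real (Suc m') \<le> 1 / real (Suc m)"
    by (simp add: field_simps)
  then show ?thesis
    unfolding bimodulus_def by (auto dest: less_le_trans)
qed

lemma Homeo_in: "f \<in> carrier (Homeo S) \<Longrightarrow> x \<in> S \<Longrightarrow> f x \<in> S"
  by (auto simp: carrier_Homeo homeomorphism_def)

lemma dist_le_mdist_homeo_metric: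
  fixes S :: "'a::metric_space set"
  assumes "compact S" "f \<in> carrier (Homeo S)" "g \<in> carrier (Homeo S)" "x \<in> S"
  shows "dist (f x) (g x) \<le> mdist (homeo_metric S) f g"
proof -
  obtain b where "\<And>y z. y \<in> S \<Longrightarrow> z \<in> S \<Longrightarrow> dist y z \<le> b"
    using compact_imp_bounded[OF assms(1)] bounded_two_points by metis
  then have "bdd_above ((\<lambda>x. dist (f x) (g x)) ` S)"
    using assms by (intro bdd_aboveI2[of _ _ b]) (auto intro: Homeo_in)
  then have "dist (f x) (g x) \<le> (SUP x\<in>S. dist (f x) (g x))"
    using assms by (intro cSUP_upper)
  then show ?thesis
    using assms by (subst mdist_homeo_metric) auto
qed

lemma openin_homeo_topologyI:
  fixes S :: "'a::metric_space set"
  assumes "compact S" "U \<subseteq> carrier (Homeo S)"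
    and "\<And>f. f \<in> U \<Longrightarrow> \<exists>r>0. \<forall>g\<in>carrier (Homeo S). (\<forall>x\<in>S. dist (f x) (g x) < r) \<longrightarrow> g \<in> U"
  shows "openin (homeo_topology S) U"
  unfolding homeo_topology_def mtopology_of_def
    Metric_space.openin_mtopology[OF Metric_space_mspace_mdist]
proof (intro conjI allI impI)
  show "U \<subseteq> mspace (homeo_metric S)"
    using assms by (simp add: mspace_homeo_metric)
  fix f assume f: "f \<in> U"
  then obtain r where r: "r > 0"
    "\<And>g. g \<in> carrier (Homeo S) \<Longrightarrow> (\<forall>x\<in>S. dist (f x) (g x) < r) \<Longrightarrow> g \<in> U"
    using assms(3) by blast
  have "Metric_space.mball (mspace (homeo_metric S)) (mdist (homeo_metric S)) f r \<subseteq> U"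
  proof
    fix g assume "g \<in> Metric_space.mball (mspace (homeo_metric S)) (mdist (homeo_metric S)) f r"
    then have g: "g \<in> carrier (Homeo S)" "mdist (homeo_metric S) f g < r"
      unfolding Metric_space.in_mball[OF Metric_space_mspace_mdist]
      using assms(1) by (simp_all add: mspace_homeo_metric)
    with r(2) f assms(2) dist_le_mdist_homeo_metric[OF assms(1)] show "g \<in> U"
      by (meson le_less_trans subsetD)
  qed
  with \<open>r > 0\<close> show "\<exists>r>0. Metric_space.mball (mspace (homeo_metric S)) (mdist (homeo_metric S)) f r \<subseteq> U"
    by blast
qed

text \<open>A violation at one pair of points survives small perturbations. The radius is half the
  slack because the images of both points may move. Openness makes these sets Borel.\<close>

lemma carrier_diff_bimodulus_open:
  fixes S :: "'a::metric_space set"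
  assumes "compact S"
  shows "openin (homeo_topology S) (carrier (Homeo S) - bimodulus S n m)"
proof (rule openin_homeo_topologyI[OF assms])
  fix f assume f: "f \<in> carrier (Homeo S) - bimodulus S n m"
  then obtain x y where xy: "x \<in> S" "y \<in> S"
    and "dist x y < 1 / Suc m \<and> dist (f x) (f y) > 1 / Suc n
       \<or> dist (f x) (f y) < 1 / Suc m \<and> dist x y > 1 / Suc n"
    unfolding bimodulus_def by (auto simp: not_le)
  then show "\<exists>r>0. \<forall>g\<in>carrier (Homeo S). (\<forall>x\<in>S. dist (f x) (g x) < r)
    \<longrightarrow> g \<in> carrier (Homeo S) - bimodulus S n m"
  proof (elim disjE conjE)
    assume *: "dist x y < 1 / Suc m" "dist (f x) (f y) > 1 / Suc n"
    define r where "r = (dist (f x) (f y) - 1 / Suc n) / 2"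
    have "g \<notin> bimodulus S n m" if "\<forall>x\<in>S. dist (f x) (g x) < r" for g
    proof -
      have "dist (f x) (g x) < r" "dist (f y) (g y) < r"
        using that xy by auto
      then have "dist (g x) (g y) > 1 / Suc n"
        unfolding r_def by metric
      with * xy show ?thesis
        by (auto simp: bimodulus_def not_le)
    qed
    with * show ?thesis
      by (intro exI[of _ r]) (auto simp: r_def)
  next
    assume *: "dist (f x) (f y) < 1 / Suc m" "dist x y > 1 / Suc n"
    define r where "r = (1 / Suc m - dist (f x) (f y)) / 2"
    have "g \<notin> bimodulus S n m" if "\<forall>x\<in>S. dist (f x) (g x) < r" for g
    proof -
      have "dist (f x) (g x) < r" "dist (f y) (g y) < r"
        using that xy by auto
      then have "dist (g x) (g y) < 1 / Suc m"
        unfolding r_def by metric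
      with * xy show ?thesis
        by (auto simp: bimodulus_def not_le)
    qed
    with * show ?thesis
      by (intro exI[of _ r]) (auto simp: r_def)
  qed
qed auto

text \<open>Uniform continuity of \<open>f\<close> and of its inverse provides the modulus. It is
  chosen with room to spare, so that the error 2r from replacing \<open>f\<close> by a nearby
  \<open>g\<close> is absorbed and one \<open>m\<close> serves a whole neighbourhood.\<close>

lemma bimodulus_neighbourhood:
  fixes S :: "'a::metric_space set"
  assumes "compact S" "f \<in> carrier (Homeo S)"
  obtains m r where "r > 0"
    "\<And>g. g \<in> carrier (Homeo S) \<Longrightarrow> (\<And>x. x \<in> S \<Longrightarrow> dist (f x) (g x) < r) \<Longrightarrow> g \<in> bimodulus S n m"
proof -
  obtain f' where hom: "homeomorphism S S f f'"
    using assms(2) by (auto simp: carrier_Homeo)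
  define \<epsilon> where "\<epsilon> = 1 / real (Suc n)"
  have \<epsilon>: "\<epsilon> > 0" "\<epsilon> / 2 > 0"
    by (auto simp: \<epsilon>_def)
  have "uniformly_continuous_on S f" "uniformly_continuous_on S f'"
    using hom assms(1) by (auto simp: homeomorphism_def intro: compact_uniformly_continuous)
  note uc = this[THEN uniformly_continuous_onE]
  obtain d where d: "d > 0"
    "\<And>x y. x \<in> S \<Longrightarrow> y \<in> S \<Longrightarrow> dist y x < d \<Longrightarrow> dist (f y) (f x) < \<epsilon> / 2"
    using uc(1)[OF \<epsilon>(2)] by blast
  obtain e where e: "e > 0"
    "\<And>x y. x \<in> S \<Longrightarrow> y \<in> S \<Longrightarrow> dist y x < e \<Longrightarrow> dist (f' y) (f' x) < \<epsilon>"
    using uc(2)[OF \<epsilon>(1)] by blast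
  obtain m where "1 / real (Suc m) < min d (e / 2)"
    using nat_approx_posE[of "min d (e / 2)"] d e by (auto simp: inverse_eq_divide)
  then have m: "1 / real (Suc m) < d" "1 / real (Suc m) < e / 2"
    by linarith+
  define r where "r = min (\<epsilon> / 4) (e / 4)"
  have r: "r > 0" "r \<le> \<epsilon> / 4" "r \<le> e / 4"
    using e \<epsilon> by (auto simp: r_def)
  moreover have "g \<in> bimodulus S n m"
    if g: "g \<in> carrier (Homeo S)" and fg: "\<And>x. x \<in> S \<Longrightarrow> dist (f x) (g x) < r" for g
    unfolding bimodulus_def \<epsilon>_def[symmetric]
  proof (intro CollectI conjI ballI impI g)
    fix x y assume xy: "x \<in> S" "y \<in> S"
    have gf: "dist (g x) (g y) \<le> dist (f x) (f y) + 2 * r" "dist (f x) (f y) \<le> dist (g x) (g y) + 2 * r"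
      using fg[OF xy(1)] fg[OF xy(2)] by metric+
    {
      assume "dist x y < 1 / Suc m"
      with d(2)[of y x] xy m have "dist (f x) (f y) < \<epsilon> / 2"
        by linarith
      then show "dist (g x) (g y) \<le> \<epsilon>"
        using gf r by linarith
    }
    {
      assume "dist (g x) (g y) < 1 / Suc m"
      then have "dist (f x) (f y) < e"
        using gf m r by linarith
      then have "dist (f' (f x)) (f' (f y)) < \<epsilon>"
        using xy assms(2) by (intro e) (auto intro: Homeo_in)
      then show "dist x y \<le> \<epsilon>"
        using hom xy by (simp add: homeomorphism_def)
    }
  qed
  ultimately show thesis
    using that by blast
qed

lemma UN_bimodulus:
  fixes S :: "'a::metric_space set"
  assumes "compact S"
  shows "(\<Union>m. bimodulus S n m) = carrier (Homeo S)"
proof -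
  have "\<exists>m. f \<in> bimodulus S n m" if f: "f \<in> carrier (Homeo S)" for f
    by (rule bimodulus_neighbourhood[OF assms f, of n]) (metis dist_self f)
  then show ?thesis
    by (auto simp: bimodulus_def)
qed

text \<open>The easy half of Arzela-Ascoli for maps and inverses: open balls contained in some
  \<open>bimodulus S n m\<close> cover \<open>K\<close>, and by monotonicity in \<open>m\<close> the
  largest index of a finite subcover works throughout.\<close>

lemma compactin_subset_bimodulus:
  fixes S :: "'a::metric_space set"
  assumes "compact S" "compactin (homeo_topology S) K"
  obtains m where "K \<subseteq> bimodulus S n m"
proof -
  define \<U> where "\<U> = {U. openin (homeo_topology S) U \<and> (\<exists>m. U \<subseteq> bimodulus S n m)}"
  have "K \<subseteq> \<Union>\<U>"
  proof
    fix f assume "f \<in> K"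
    then have f: "f \<in> carrier (Homeo S)"
      using assms compactin_subset_topspace topspace_homeo_topology by blast
    then obtain m r where r: "r > 0"
      "\<And>g. g \<in> carrier (Homeo S) \<Longrightarrow> (\<And>x. x \<in> S \<Longrightarrow> dist (f x) (g x) < r) \<Longrightarrow> g \<in> bimodulus S n m"
      using bimodulus_neighbourhood[OF assms(1)] by metis
    define V where "V = Metric_space.mball (mspace (homeo_metric S)) (mdist (homeo_metric S)) f r"
    have V: "V = {g \<in> carrier (Homeo S). mdist (homeo_metric S) f g < r}"
      unfolding V_def Metric_space.mball_def[OF Metric_space_mspace_mdist]
      using f assms by (auto simp: mspace_homeo_metric)
    have "openin (homeo_topology S) V"
      unfolding V_def homeo_topology_def mtopology_of_def
      by (rule Metric_space.openin_mball[OF Metric_space_mspace_mdist])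
    moreover have "V \<subseteq> bimodulus S n m"
      unfolding V using r(2) dist_le_mdist_homeo_metric[OF assms(1) f] by (fastforce intro: le_less_trans)
    moreover have "f \<in> V"
      unfolding V_def Metric_space.centre_in_mball_iff[OF Metric_space_mspace_mdist]
      using f r(1) assms by (simp add: mspace_homeo_metric)
    ultimately show "f \<in> \<Union>\<U>"
      by (auto simp: \<U>_def)
  qed
  then obtain F where F: "finite F" "F \<subseteq> \<U>" "K \<subseteq> \<Union>F"
    using compactinD[OF assms(2), of \<U>] by (auto simp: \<U>_def)
  then have "\<forall>U\<in>F. \<exists>m. U \<subseteq> bimodulus S n m"
    by (auto simp: \<U>_def)
  from bchoice[OF this] obtain M where M: "\<And>U. U \<in> F \<Longrightarrow> U \<subseteq> bimodulus S n (M U)"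
    by blast
  have "U \<subseteq> bimodulus S n (Max (M ` F))" if "U \<in> F" for U
    by (rule order_trans[OF M[OF that] bimodulus_mono]) (simp add: F(1) that)
  with F(3) have "K \<subseteq> bimodulus S n (Max (M ` F))"
    by blast
  then show thesis
    by (rule that)
qed

text \<open>Every compact set lies in an intersection of sets \<open>bimodulus S n (m n)\<close> for
  some sequence \<open>m\<close>, so it suffices to catch these intersections.\<close>

lemma compact_catcherI:
  fixes S :: "'a::metric_space set"
  assumes "compact S" "X \<subseteq> carrier (Homeo S)"
    and catch: "\<And>m. \<exists>g\<in>carrier (Homeo S). \<exists>h\<in>carrier (Homeo S).
      (g <#\<^bsub>Homeo S\<^esub> (\<Inter>n. bimodulus S n (m n))) #>\<^bsub>Homeo S\<^esub> h \<subseteq> X"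
  shows "compact_catcher (Homeo S) (homeo_topology S) X"
  unfolding compact_catcher_def
proof (intro conjI assms allI impI)
  fix K assume K: "compactin (homeo_topology S) K"
  have "\<exists>m. K \<subseteq> bimodulus S n m" for n
    using compactin_subset_bimodulus[OF assms(1) K] by blast
  then obtain m where "\<And>n. K \<subseteq> bimodulus S n (m n)"
    by metis
  then have *: "K \<subseteq> (\<Inter>n. bimodulus S n (m n))"
    by blast
  obtain g h where gh: "g \<in> carrier (Homeo S)" "h \<in> carrier (Homeo S)"
    "(g <#\<^bsub>Homeo S\<^esub> (\<Inter>n. bimodulus S n (m n))) #>\<^bsub>Homeo S\<^esub> h \<subseteq> X"
    using catch by blast
  from * have "(g <#\<^bsub>Homeo S\<^esub> K) #>\<^bsub>Homeo S\<^esub> h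
    \<subseteq> (g <#\<^bsub>Homeo S\<^esub> (\<Inter>n. bimodulus S n (m n))) #>\<^bsub>Homeo S\<^esub> h"
    unfolding l_coset_def r_coset_def by blast
  with gh show "\<exists>g\<in>carrier (Homeo S). \<exists>h\<in>carrier (Homeo S).
      (g <#\<^bsub>Homeo S\<^esub> K) #>\<^bsub>Homeo S\<^esub> h \<subseteq> X"
    by blast
qed

text \<open>
  The intersections below play the role of compact sets of positive measure, so tightness of
  Borel measures on Polish spaces is not needed.
\<close>

lemma not_haar_nullI:
  fixes S :: "'a::metric_space set"
  assumes "compact S"
    and catch: "\<And>m. \<exists>g\<in>carrier (Homeo S). \<exists>h\<in>carrier (Homeo S).
      (g <#\<^bsub>Homeo S\<^esub> (\<Inter>n. bimodulus S n (m n))) #>\<^bsub>Homeo S\<^esub> h \<subseteq> X"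
  shows "\<not> haar_null (Homeo S) (homeo_topology S) X"
proof
  let ?G = "Homeo S"
  interpret group ?G by (rule group_Homeo)
  assume "haar_null ?G (homeo_topology S) X"
  then obtain \<mu> B where \<mu>: "sets \<mu> = sets (borel_of (homeo_topology S))" "prob_space \<mu>"
    and B: "B \<in> sets (borel_of (homeo_topology S))" "X \<subseteq> B"
    and null: "\<And>g h. g \<in> carrier ?G \<Longrightarrow> h \<in> carrier ?G \<Longrightarrow> (g <#\<^bsub>?G\<^esub> B) #>\<^bsub>?G\<^esub> h \<in> null_sets \<mu>"
    unfolding haar_null_def by blast
  interpret \<mu>: prob_space \<mu> by (rule \<mu>)
  have sub: "{U. openin (homeo_topology S) U} \<subseteq> Pow (topspace (homeo_topology S))"
    using openin_subset by blast
  have space: "space \<mu> = carrier ?G"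
    using sets_eq_imp_space_eq[OF \<mu>(1)] assms(1) sub
    by (simp add: borel_of_def space_measure_of topspace_homeo_topology)
  have meas: "carrier ?G - bimodulus S n m \<in> sets \<mu>" for n m
    unfolding \<mu>(1) borel_of_def using carrier_diff_bimodulus_open[OF assms(1)]
    by (subst sets_measure_of[OF sub]) (auto intro: sigma_sets.Basic)
  \<comment> \<open>For fixed \<open>n\<close> the complements decrease to the empty set. The bounds
    2^-(n+2) add up to 1/2, which leaves mass at least 1/2 for the intersection
    \<open>K\<close>.\<close>
  have "\<exists>m. measure \<mu> (carrier ?G - bimodulus S n m) < (1/2) ^ Suc (Suc n)" for n
  proof -
    have "decseq (\<lambda>m. carrier ?G - bimodulus S n m)"
      using bimodulus_mono[of _ _ S n] by (auto simp: decseq_def)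
    moreover have "(\<Inter>m. carrier ?G - bimodulus S n m) = {}"
      using UN_bimodulus[OF assms(1), of n] by blast
    ultimately have "(\<lambda>m. measure \<mu> (carrier ?G - bimodulus S n m)) \<longlonglongrightarrow> 0"
      using \<mu>.finite_Lim_measure_decseq[of "\<lambda>m. carrier ?G - bimodulus S n m"] meas
      by (metis image_subset_iff measure_empty)
    from order_tendstoD(2)[OF this, of "(1/2) ^ Suc (Suc n)"] show ?thesis
      by (auto simp: eventually_sequentially)
  qed
  then obtain m where m: "\<And>n. measure \<mu> (carrier ?G - bimodulus S n (m n)) < (1/2) ^ Suc (Suc n)"
    by metis
  define K where "K = (\<Inter>n. bimodulus S n (m n))"
  have K_sub: "K \<subseteq> carrier ?G"
    by (auto simp: K_def bimodulus_def)
  have geo: "(\<lambda>n. (1/2) ^ Suc (Suc n) :: real) sums (1/2)"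
    using sums_mult[OF geometric_sums[of "1/2::real"], of "1/4"] by simp
  have summ: "summable (\<lambda>n. measure \<mu> (carrier ?G - bimodulus S n (m n)))"
    by (rule summable_comparison_test'[OF sums_summable[OF geo]]) (use m less_imp_le in auto)
  have eq: "carrier ?G - K = (\<Union>n. carrier ?G - bimodulus S n (m n))"
    by (auto simp: K_def)
  have "measure \<mu> (carrier ?G - K) \<le> (\<Sum>n. measure \<mu> (carrier ?G - bimodulus S n (m n)))"
    unfolding eq using meas summ by (intro \<mu>.finite_measure_subadditive_countably) auto
  also have "\<dots> \<le> 1/2"
    using suminf_le[OF _ summ sums_summable[OF geo]] m sums_unique[OF geo] by (auto simp: less_imp_le)
  finally have "measure \<mu> (carrier ?G - K) \<le> 1/2" .
  moreover have Kc: "carrier ?G - K \<in> sets \<mu>"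
    unfolding eq using meas by (intro sets.countable_UN) auto
  then have "measure \<mu> K = 1 - measure \<mu> (carrier ?G - K)"
    using \<mu>.prob_compl[OF Kc] K_sub by (simp add: space double_diff)
  ultimately have "measure \<mu> K > 0"
    by linarith
  obtain g h where gh: "g \<in> carrier ?G" "h \<in> carrier ?G" "(g <#\<^bsub>?G\<^esub> K) #>\<^bsub>?G\<^esub> h \<subseteq> X"
    using catch[of m] by (auto simp: K_def)
  \<comment> \<open>Undoing the translation that puts \<open>K\<close> inside \<open>X\<close>, and
    hence inside \<open>B\<close>, places \<open>K\<close> in a two-sided translate of
    \<open>B\<close>, which is \<open>\<mu>\<close>-null.\<close>
  have "K \<subseteq> (inv\<^bsub>?G\<^esub> g <#\<^bsub>?G\<^esub> B) #>\<^bsub>?G\<^esub> inv\<^bsub>?G\<^esub> h"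
  proof
    fix k assume k: "k \<in> K"
    define b where "b = g \<otimes>\<^bsub>?G\<^esub> k \<otimes>\<^bsub>?G\<^esub> h"
    have "b \<in> B"
      using gh B k unfolding b_def l_coset_def r_coset_def by blast
    moreover have kc: "k \<in> carrier ?G"
      using k K_sub by blast
    then have "inv\<^bsub>?G\<^esub> g \<otimes>\<^bsub>?G\<^esub> b = k \<otimes>\<^bsub>?G\<^esub> h"
      using gh by (simp add: b_def m_assoc[symmetric])
    then have "inv\<^bsub>?G\<^esub> g \<otimes>\<^bsub>?G\<^esub> b \<otimes>\<^bsub>?G\<^esub> inv\<^bsub>?G\<^esub> h = k"
      using gh kc by (simp add: m_assoc)
    ultimately show "k \<in> (inv\<^bsub>?G\<^esub> g <#\<^bsub>?G\<^esub> B) #>\<^bsub>?G\<^esub> inv\<^bsub>?G\<^esub> h"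
      unfolding l_coset_def r_coset_def by blast
  qed
  moreover have "(inv\<^bsub>?G\<^esub> g <#\<^bsub>?G\<^esub> B) #>\<^bsub>?G\<^esub> inv\<^bsub>?G\<^esub> h \<in> null_sets \<mu>"
    using gh by (intro null) auto
  ultimately have "measure \<mu> K \<le> 0"
    by (metis \<mu>.finite_measure_mono null_setsD2 measure_eq_0_null_sets)
  with \<open>measure \<mu> K > 0\<close> show False
    by simp
qed

section \<open>A uniformly rough function\<close>

lemma abs_cos_diff_le: "\<bar>cos x - cos y\<bar> \<le> \<bar>x - y\<bar>" for x y :: real
proof -
  have "\<bar>cos x - cos y\<bar> = 2 * \<bar>sin ((x + y) / 2)\<bar> * \<bar>sin ((y - x) / 2)\<bar>"
    by (simp add: cos_diff_cos abs_mult)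
  also have "\<dots> \<le> 2 * 1 * \<bar>(y - x) / 2\<bar>"
    by (intro mult_mono abs_sin_x_le_abs_x abs_sin_le_one) auto
  finally show ?thesis by simp
qed

text \<open>If \<bar>cos x\<bar> \<ge> 1/4, a half turn reverses the sign. Otherwise \<bar>sin
  x\<bar> \<ge> 3/4, and a quarter turn replaces the cosine by the sine up to sign. Either works in
  the prescribed direction \<open>\<sigma>\<close>.\<close>

lemma cos_quarter_or_half_turn:
  fixes x :: real
  assumes "\<sigma> = 1 \<or> \<sigma> = -1"
  obtains \<theta> where "0 \<le> \<theta>" "\<theta> \<le> pi" "\<bar>cos (x + \<sigma> * \<theta>) - cos x\<bar> \<ge> 1/2"
proof (cases "\<bar>cos x\<bar> \<ge> 1/4")
  case True
  have "cos (x + \<sigma> * pi) = - cos x"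
    using assms by (auto simp: cos_add cos_diff)
  with True show thesis
    by (intro that[of pi]) auto
next
  case False
  have "(cos x)\<^sup>2 \<le> (1/4)\<^sup>2"
    using False by (intro abs_le_square_iff[THEN iffD1]) auto
  then have "(3/4)\<^sup>2 \<le> (sin x)\<^sup>2"
    using sin_cos_squared_add[of x] by (simp add: power2_eq_square)
  then have "3/4 \<le> \<bar>sin x\<bar>"
    using abs_le_square_iff[of "3/4" "sin x"] by simp
  moreover have "\<bar>cos (x + \<sigma> * (pi/2))\<bar> = \<bar>sin x\<bar>"
    using assms by (auto simp: cos_add cos_diff)
  ultimately have "\<bar>cos (x + \<sigma> * (pi/2)) - cos x\<bar> \<ge> 1/2"
    using False by linarith
  then show thesis
    by (intro that[of "pi/2"]) auto
qed

text \<open>A Weierstrass-type lacunary series with amplitudes 8^-(n+1) and frequencies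
  \<open>b n\<close> that grow as fast as \<open>\<delta>\<close> demands.\<close>

lemma exists_rough_function:
  fixes \<delta> :: "nat \<Rightarrow> real"
  assumes \<delta>: "\<And>n. \<delta> n > 0"
  obtains w :: "real \<Rightarrow> real" where "continuous_on UNIV w" "\<And>s. \<bar>w s\<bar> \<le> 1/2"
    "\<And>n s. s \<in> {0..1} \<Longrightarrow> \<exists>s'\<in>{0..1}. \<bar>s' - s\<bar> < \<delta> n \<and> \<bar>w s' - w s\<bar> \<ge> (1/8) ^ (n + 2)"
proof -
  define a :: "nat \<Rightarrow> real" where "a n = (1/8) ^ Suc n" for n
  \<comment> \<open>With frequency at least \<open>c n\<close>, a half turn takes a displacement of
    at most 1/(2(1 + 1/\<open>\<delta> n\<close>)), which is less than \<open>\<delta> n\<close> and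
    at most 1/2.\<close>
  define c where "c n = 2 * pi * (1 + 1 / \<delta> n)" for n
  \<comment> \<open>The second argument of the maximum makes the frequency jump so large that all
    earlier summands together change by at most \<open>a n / 16\<close> over a half turn of the n-th
    one.\<close>
  define b where "b = rec_nat (c 0) (\<lambda>n r. max (c (Suc n)) (r * (16 * pi / a (Suc n))))"
  have b_Suc: "b (Suc n) = max (c (Suc n)) (b n * (16 * pi / a (Suc n)))" and b_0: "b 0 = c 0" for n
    by (auto simp: b_def)
  have a: "a n > 0" "a n \<le> 1/8" for n
    by (auto simp: a_def power_le_one)
  have c: "c n > 2 * pi" for n
    using \<delta>[of n] by (simp add: c_def)
  have b_ge: "b n \<ge> c n" for n
    by (cases n) (auto simp: b_Suc b_0)
  have b_pos: "b n > 0" for n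
    using b_ge[of n] c[of n] pi_gt_zero by linarith
  have b_step: "b n * (16 * pi / a (Suc n)) \<le> b (Suc n)" for n
    by (simp add: b_Suc)
  have b_double: "2 * b n \<le> b (Suc n)" for n
  proof -
    have "2 \<le> 16 * pi / a (Suc n)"
      using a[of "Suc n"] pi_gt3 by (simp add: field_simps)
    from mult_left_mono[OF this, of "b n"] b_pos[of n] b_step[of n] show ?thesis
      by linarith
  qed
  \<comment> \<open>The left-hand side is a Lipschitz constant for the first n+1 summands. The
    induction uses that \<open>b\<close> at least doubles and that a \<le> 1/8.\<close>
  have ab: "(\<Sum>k<Suc n. a k * b k) \<le> b n" for n
  proof (induction n)
    case 0
    show ?case using a[of 0] b_pos[of 0] by simp
  next
    case (Suc n)
    have "a (Suc n) * b (Suc n) \<le> 1/8 * b (Suc n)"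
      using a[of "Suc n"] b_pos[of "Suc n"] by (intro mult_right_mono) auto
    then show ?case
      using Suc b_double[of n] b_pos[of "Suc n"] unfolding sum.lessThan_Suc[of _ "Suc n"] by linarith
  qed
  have sum_a: "a sums (1/7)"
    unfolding a_def using sums_mult[OF geometric_sums[of "1/8::real"], of "1/8"] by simp
  define t where "t n s = a n * cos (b n * s)" for n s
  define w where "w s = (\<Sum>n. t n s)" for s
  have t_le: "\<bar>t n s\<bar> \<le> a n" for n s
    using a[of n] by (simp add: t_def abs_mult mult_le_cancel_left1)
  have sum_abs_t: "summable (\<lambda>n. \<bar>t n s\<bar>)" for s
    by (rule summable_comparison_test'[OF sums_summable[OF sum_a]]) (simp add: t_le)
  have sum_t: "summable (\<lambda>n. t n s)" for s
    by (rule summable_rabs_cancel[OF sum_abs_t])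
  have "continuous_on UNIV w"
  proof (rule uniform_limit_theorem)
    show "uniform_limit UNIV (\<lambda>n s. \<Sum>k<n. t k s) w sequentially"
      unfolding w_def
      by (rule Weierstrass_m_test[OF _ sums_summable[OF sum_a]]) (simp add: t_le)
    show "\<forall>\<^sub>F n in sequentially. continuous_on UNIV (\<lambda>s. \<Sum>k<n. t k s)"
      unfolding t_def by (intro always_eventually allI continuous_intros)
  qed simp
  moreover have "\<bar>w s\<bar> \<le> 1/2" for s
  proof -
    have "\<bar>w s\<bar> \<le> (\<Sum>n. \<bar>t n s\<bar>)"
      unfolding w_def by (rule summable_rabs[OF sum_abs_t])
    also have "\<dots> \<le> (\<Sum>n. a n)"
      by (rule suminf_le[OF t_le sum_abs_t sums_summable[OF sum_a]])
    finally show ?thesis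
      using sums_unique[OF sum_a] by simp
  qed
  moreover have "\<exists>s'\<in>{0..1}. \<bar>s' - s\<bar> < \<delta> n \<and> \<bar>w s' - w s\<bar> \<ge> (1/8) ^ (n + 2)"
    if s: "s \<in> {0..1}" for n s
  proof -
    txt \<open>At scale \<open>1 / b n\<close> the \<open>n\<close>-th summand dominates: the earlier ones vary slowly there, and the
      later ones are small. The sign \<open>\<sigma>\<close> keeps the test point inside the unit interval.\<close>
    define \<sigma> :: real where "\<sigma> = (if s \<le> 1/2 then 1 else -1)"
    obtain \<theta> where \<theta>: "0 \<le> \<theta>" "\<theta> \<le> pi" "\<bar>cos (b n * s + \<sigma> * \<theta>) - cos (b n * s)\<bar> \<ge> 1/2"
      by (rule cos_quarter_or_half_turn[of \<sigma> "b n * s"]) (auto simp: \<sigma>_def)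
    define s' where "s' = s + \<sigma> * (\<theta> / b n)"
    have bs': "b n * s' = b n * s + \<sigma> * \<theta>"
      using b_pos[of n] by (simp add: s'_def field_simps)
    have dist: "\<bar>s' - s\<bar> = \<theta> / b n"
      using \<theta> b_pos[of n] by (auto simp: s'_def \<sigma>_def)
    have pb: "\<theta> / b n \<le> pi / b n"
      using \<theta> b_pos[of n] by (simp add: divide_right_mono)
    have "pi / b n \<le> pi / c n"
      using b_ge[of n] c[of n] pi_gt_zero b_pos[of n] by (intro divide_left_mono mult_pos_pos) linarith+
    also have "pi / c n = 1 / (2 * (1 + 1 / \<delta> n))"
      by (simp add: c_def)
    finally have pc: "\<theta> / b n \<le> 1 / (2 * (1 + 1 / \<delta> n))"
      using pb by linarith
    have "1 / (2 * (1 + 1 / \<delta> n)) \<le> 1/2" "1 / (2 * (1 + 1 / \<delta> n)) < \<delta> n"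
      using \<delta>[of n] by (auto simp: field_simps intro: add_pos_pos)
    then have small: "\<theta> / b n \<le> 1/2" "\<bar>s' - s\<bar> < \<delta> n"
      using pc dist by linarith+
    moreover have "0 \<le> \<theta> / b n"
      using \<theta> b_pos[of n] by simp
    ultimately have "s' \<in> {0..1}"
      using s unfolding s'_def \<sigma>_def atLeastAtMost_iff
      by (cases "s \<le> 1/2") (simp_all only: if_True if_False mult_1 mult_minus1, linarith+)
    define d where "d k = t k s' - t k s" for k
    have d_sum: "summable d"
      unfolding d_def by (intro summable_diff sum_t)
    have "w s' - w s = (\<Sum>k. d k)"
      by (simp add: w_def d_def suminf_diff[OF sum_t sum_t])
    also have "\<dots> = (\<Sum>k. d (k + Suc n)) + (\<Sum>k<n. d k) + d n"
      using suminf_split_initial_segment[OF d_sum, of "Suc n"] by simp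
    finally have split: "w s' - w s = (\<Sum>k. d (k + Suc n)) + (\<Sum>k<n. d k) + d n" .
    have "\<bar>d n\<bar> = a n * \<bar>cos (b n * s + \<sigma> * \<theta>) - cos (b n * s)\<bar>"
      using a[of n] by (simp add: d_def t_def bs' abs_mult right_diff_distrib[symmetric])
    then have main: "\<bar>d n\<bar> \<ge> a n / 2"
      using mult_left_mono[OF \<theta>(3), of "a n"] a[of n] by simp
    have early: "\<bar>\<Sum>k<n. d k\<bar> \<le> a n / 16"
    proof (cases n)
      case 0
      then show ?thesis using a[of 0] by simp
    next
      case (Suc m)
      have "\<bar>d k\<bar> \<le> (a k * b k) * (\<theta> / b n)" for k
      proof -
        have "\<bar>d k\<bar> = a k * \<bar>cos (b k * s') - cos (b k * s)\<bar>"
          using a[of k] by (simp add: d_def t_def abs_mult right_diff_distrib[symmetric])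
        also have "\<dots> \<le> a k * \<bar>b k * s' - b k * s\<bar>"
          using a[of k] by (intro mult_left_mono abs_cos_diff_le) auto
        also have "\<bar>b k * s' - b k * s\<bar> = b k * (\<theta> / b n)"
          using b_pos[of k] dist by (simp only: right_diff_distrib[symmetric] abs_mult)
        finally show ?thesis by (simp add: mult_ac)
      qed
      then have "\<bar>\<Sum>k<n. d k\<bar> \<le> (\<Sum>k<n. (a k * b k) * (\<theta> / b n))"
        by (intro order_trans[OF sum_abs] sum_mono)
      also have "\<dots> = (\<Sum>k<Suc m. a k * b k) * (\<theta> / b n)"
        by (simp only: Suc sum_distrib_right)
      also have "\<dots> \<le> b m * (pi / b n)"
        using b_pos[of m] b_pos[of n] \<theta> by (intro mult_mono ab pb) auto
      also have "\<dots> \<le> a n / 16"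
        using b_step[of m] b_pos[of n] a[of n] by (simp add: Suc field_simps)
      finally show ?thesis .
    qed
    have late: "\<bar>\<Sum>k. d (k + Suc n)\<bar> \<le> 2 * a n / 7"
    proof -
      have geo: "(\<lambda>k. 2 * (a n * a k)) sums (2 * (a n * (1/7)))"
        by (intro sums_mult sum_a)
      have d_le: "\<bar>d (k + Suc n)\<bar> \<le> 2 * (a n * a k)" for k
      proof -
        have "a (k + Suc n) = a n * a k"
          by (simp add: a_def power_add)
        then show ?thesis
          using t_le[of "k + Suc n" s] t_le[of "k + Suc n" s'] unfolding d_def by linarith
      qed
      have abs_sum: "summable (\<lambda>k. \<bar>d (k + Suc n)\<bar>)"
        by (rule summable_comparison_test'[OF sums_summable[OF geo]]) (simp only: real_norm_def abs_idempotent d_le)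
      have "\<bar>\<Sum>k. d (k + Suc n)\<bar> \<le> (\<Sum>k. \<bar>d (k + Suc n)\<bar>)"
        by (rule summable_rabs[OF abs_sum])
      also have "\<dots> \<le> (\<Sum>k. 2 * (a n * a k))"
        by (rule suminf_le[OF d_le abs_sum sums_summable[OF geo]])
      finally show ?thesis
        using sums_unique[OF geo] by simp
    qed
    have "(1/8) ^ (n + 2) = a n / 8"
      by (simp add: a_def)
    \<comment> \<open>The n-th summand wins because 1/2 - 1/16 - 2/7 > 1/8.\<close>
    then have "\<bar>w s' - w s\<bar> \<ge> (1/8) ^ (n + 2)"
      using split main early late a[of n] by linarith
    with small \<open>s' \<in> {0..1}\<close> show ?thesis
      by blast
  qed
  ultimately show thesis
    using that by blast
qed

section \<open>Homeomorphisms of the cube\<close>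

lemma mult_Homeo:
  assumes "f \<in> carrier (Homeo S)" "g \<in> carrier (Homeo S)"
  shows "f \<otimes>\<^bsub>Homeo S\<^esub> g = compose S f g"
proof -
  have "f \<in> Bij S" "g \<in> Bij S"
    using assms subgroup.subset[OF subgroup_Homeo, of S] by (auto simp: BijGroup_def)
  then show ?thesis
    by (simp add: Homeo_def BijGroup_def)
qed

lemma restrict_in_Homeo:
  fixes f :: "'a::t2_space \<Rightarrow> 'a"
  assumes "compact S" "continuous_on S f" "f ` S = S" "inj_on f S"
  shows "restrict f S \<in> carrier (Homeo S)"
proof -
  obtain g where "homeomorphism S S f g"
    using homeomorphism_compact[OF assms] by blast
  then have "homeomorphism S S (restrict f S) g"
    by (rule homeomorphism_cong) auto
  then show ?thesis
    by (auto simp: carrier_Homeo)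
qed

section \<open>The cube, its interior and null sets given by one coordinate\<close>

lemma unit_cube_eq_cbox: "unit_cube = cbox (0 :: real ^ 'n) 1"
  by (auto simp: unit_cube_def mem_box_cart)

lemma mem_unit_cube: "x \<in> unit_cube \<longleftrightarrow> (\<forall>i. x $ i \<in> {0..1})"
  by (auto simp: unit_cube_def)

lemma compact_unit_cube: "compact (unit_cube :: (real ^ 'n) set)"
  by (simp add: unit_cube_eq_cbox)

lemma interior_unit_cube: "interior (unit_cube :: (real ^ 'n) set) = {x. \<forall>i. 0 < x $ i \<and> x $ i < 1}"
  by (auto simp: unit_cube_eq_cbox interior_cbox mem_box_cart)

lemma negligible_unit_cube_diff_interior: "negligible (unit_cube - interior (unit_cube :: (real ^ 'n) set))"
  using negligible_frontier_interval by (simp add: unit_cube_eq_cbox)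

text \<open>Lebesgue measure on the slab \<open>T\<close>, where every coordinate but the i-th is
  confined to (0,1), projects to Lebesgue measure on the line under the i-th coordinate. Preimages
  of null sets in the slab are therefore null.\<close>

lemma negligible_component_vimage:
  fixes i :: "'n::finite"
  assumes "negligible B"
  shows "negligible {x \<in> interior (unit_cube :: (real ^ 'n) set). x $ i \<in> B}"
proof -
  define T :: "(real ^ 'n) set" where "T = {x. \<forall>j. j \<noteq> i \<longrightarrow> 0 < x $ j \<and> x $ j < 1}"
  have "T = (\<Inter>j\<in>UNIV - {i}. {x. 0 < x $ j} \<inter> {x. x $ j < 1})"
    by (auto simp: T_def)
  also have "open \<dots>"
    by (intro open_INT ballI open_Int open_Collect_less continuous_intros) auto
  finally have "open T" .
  then have T[measurable]: "T \<in> sets borel"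
    by simp
  have comp [measurable]: "(\<lambda>x :: real ^ 'n. x $ i) \<in> borel_measurable borel"
    by (intro borel_measurable_continuous_onI continuous_intros)
  define M where "M = distr (density lborel (indicator T)) borel (\<lambda>x. x $ i)"
  have em: "emeasure M A = emeasure lborel (T \<inter> {x. x $ i \<in> A})" if "A \<in> sets borel" for A
  proof -
    have "(\<lambda>x :: real ^ 'n. x $ i) -` A \<inter> space borel \<in> sets borel"
      using that by measurable
    then have [measurable]: "{x :: real ^ 'n. x $ i \<in> A} \<in> sets borel"
      by (simp add: vimage_def)
    have "emeasure M A = emeasure (density lborel (indicator T)) {x. x $ i \<in> A}"
      unfolding M_def using that by (subst emeasure_distr) (auto simp: vimage_def)
    also have "\<dots> = (\<integral>\<^sup>+x. indicator (T \<inter> {x. x $ i \<in> A}) x \<partial>lborel)"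
      unfolding indicator_inter_arith by (subst emeasure_density) auto
    also have "\<dots> = emeasure lborel (T \<inter> {x. x $ i \<in> A})"
      by (rule nn_integral_indicator) auto
    finally show ?thesis .
  qed
  have M: "lborel = M"
  proof (rule lborel_eqI)
    fix l u :: real assume "\<And>b. b \<in> Basis \<Longrightarrow> l \<bullet> b \<le> u \<bullet> b"
    then have lu: "l \<le> u"
      by simp
    define a b :: "real ^ 'n" where "a = (\<chi> j. if j = i then l else 0)" and "b = (\<chi> j. if j = i then u else 1)"
    have eq: "T \<inter> {x. x $ i \<in> box l u} = box a b"
      by (auto simp: T_def a_def b_def mem_box_cart mem_box split: if_splits)
    have le: "a \<bullet> k \<le> b \<bullet> k" if "k \<in> Basis" for k
      using that lu by (auto simp: a_def b_def Basis_vec_def inner_axis)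
    then have "cbox a b \<noteq> {}"
      using box_ne_empty(1) by blast
    have "emeasure lborel (box a b) = ennreal (\<Prod>k\<in>Basis. (b - a) \<bullet> k)"
      using le by simp
    also have "(\<Prod>k\<in>Basis. (b - a) \<bullet> k) = measure lborel (cbox a b)"
      using le by (simp add: content_cbox)
    also have "\<dots> = (\<Prod>j\<in>UNIV. b $ j - a $ j)"
      using \<open>cbox a b \<noteq> {}\<close> by (rule content_cbox_cart)
    also have "\<dots> = (\<Prod>j\<in>UNIV. if j = i then u - l else 1)"
      by (intro prod.cong) (auto simp: a_def b_def)
    also have "\<dots> = u - l"
      by simp
    finally show "emeasure M (box l u) = (\<Prod>b\<in>Basis. (u - l) \<bullet> b)"
      unfolding em[OF borel_open[OF open_box]] eq by simp
  qed (simp add: M_def)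
  \<comment> \<open>\<open>B\<close> is only Lebesgue null, so it is enclosed in a Borel null set,
    to which the projection formula applies.\<close>
  obtain N where N: "N \<in> null_sets lborel" "B \<subseteq> N"
    using assms by (auto simp: negligible_iff_null_sets null_sets_completion_iff2)
  then have "emeasure M N = 0"
    unfolding M[symmetric] by auto
  then have "emeasure lborel (T \<inter> {x. x $ i \<in> N}) = 0"
    using em[of N] N by auto
  moreover have "(\<lambda>x :: real ^ 'n. x $ i) -` N \<inter> space borel \<in> sets borel"
    using N by (intro measurable_sets[OF comp]) auto
  then have "T \<inter> {x. x $ i \<in> N} \<in> sets lborel"
    using T by (simp add: vimage_def)
  ultimately have "T \<inter> {x. x $ i \<in> N} \<in> null_sets lborel"
    by auto
  then have "negligible (T \<inter> {x. x $ i \<in> N})"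
    by (simp add: negligible_iff_null_sets null_sets_completionI)
  then show ?thesis
    by (rule negligible_subset) (use N in \<open>auto simp: T_def interior_unit_cube\<close>)
qed

section \<open>Criteria for strong singularity and for derivatives\<close>

lemma strongly_singularI:
  fixes f :: "real ^ 'n \<Rightarrow> real ^ 'n"
  assumes "negligible N"
    and "\<And>x. x \<in> interior unit_cube \<Longrightarrow> x \<notin> N \<Longrightarrow> (f has_derivative (\<lambda>_. 0)) (at x within unit_cube)"
  shows "strongly_singular f"
proof -
  have *: "f differentiable (at x within unit_cube) \<and> det (jacobian f (at x within unit_cube)) = 0"
    if x: "x \<in> interior unit_cube" "x \<notin> N" for x
  proof -
    have eq: "at x within unit_cube = at x"
      by (rule at_within_interior[OF x(1)])
    with assms(2)[OF x] have d: "(f has_derivative (\<lambda>_. 0)) (at x)"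
      by simp
    have "jacobian f (at x) = matrix (\<lambda>_. 0)"
      by (simp add: jacobian_def frechet_derivative_at[OF d, symmetric])
    also have "\<dots> = mat 0"
      by (simp add: matrix_def mat_def vec_eq_iff)
    finally have "det (jacobian f (at x)) = 0"
      by (simp only: det_0)
    then show ?thesis
      using d by (auto simp: eq differentiable_def)
  qed
  have "negligible (N \<union> (unit_cube - interior (unit_cube :: (real ^ 'n) set)))"
    using assms(1) negligible_unit_cube_diff_interior by (rule negligible_Un)
  then have "AE x in lebesgue. x \<in> unit_cube \<longrightarrow> f differentiable (at x within unit_cube) \<and>
        det (jacobian f (at x within unit_cube)) = 0"
    unfolding negligible_iff_null_sets by (rule AE_I') (use * in auto)
  moreover have "unit_cube \<in> sets (lebesgue :: (real ^ 'n) measure)"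
    by (simp add: unit_cube_eq_cbox)
  ultimately show ?thesis
    unfolding strongly_singular_def by (subst AE_restrict_space_iff) auto
qed

text \<open>Otherwise the interior of the cube, a nonempty open set, would be null.\<close>

lemma not_strongly_singularI:
  fixes f :: "real ^ 'n \<Rightarrow> real ^ 'n"
  assumes "\<And>x. x \<in> interior unit_cube \<Longrightarrow> \<not> f differentiable (at x within unit_cube)"
  shows "\<not> strongly_singular f"
proof
  assume "strongly_singular f"
  moreover have "unit_cube \<in> sets (lebesgue :: (real ^ 'n) measure)"
    by (simp add: unit_cube_eq_cbox)
  ultimately have "AE x in lebesgue. x \<in> unit_cube \<longrightarrow> f differentiable (at x within unit_cube) \<and>
        det (jacobian f (at x within unit_cube)) = 0"
    unfolding strongly_singular_def by (subst (asm) AE_restrict_space_iff) auto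
  then have "AE x in lebesgue. x \<notin> interior (unit_cube :: (real ^ 'n) set)"
    by eventually_elim (use assms interior_subset in blast)
  then have "negligible (interior (unit_cube :: (real ^ 'n) set))"
    by (auto simp: completion.AE_iff_null_sets negligible_iff_null_sets)
  moreover have "(\<chi> i. 1/2) \<in> interior (unit_cube :: (real ^ 'n) set)"
    by (simp add: interior_unit_cube)
  ultimately show False
    using open_not_negligible[OF open_interior] by blast
qed

text \<open>If t = norm (y - x) satisfies 2^-(n+1) < t \<le> 2^-n, the increment is at most 4^-n = 4
  * (2^-(n+1))^2 < 4 * t^2, which is o(t).\<close>

lemma has_derivative_0_if_dyadic_decay:
  fixes f :: "'a::real_normed_vector \<Rightarrow> 'b::real_normed_vector"
  assumes "\<forall>\<^sub>F n in sequentially. \<forall>y\<in>S. norm (y - x) \<le> (1/2) ^ n \<longrightarrow> norm (f y - f x) \<le> (1/4) ^ n"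
  shows "(f has_derivative (\<lambda>_. 0)) (at x within S)"
  unfolding has_derivative_within_alt
proof (intro conjI allI impI)
  fix e :: real assume e: "e > 0"
  obtain N where N: "\<And>n y. n \<ge> N \<Longrightarrow> y \<in> S \<Longrightarrow> norm (y - x) \<le> (1/2) ^ n \<Longrightarrow> norm (f y - f x) \<le> (1/4) ^ n"
    using assms by (auto simp: eventually_sequentially)
  \<comment> \<open>The first bound forces the dyadic scale of \<open>y\<close> to be at least
    \<open>N\<close>; the second turns 4 * t^2 into at most e * t.\<close>
  define d where "d = min ((1/2) ^ N) (e / 4)"
  have "norm (f y - f x) \<le> e * norm (y - x)" if y: "y \<in> S" "norm (y - x) < d" for y
  proof (cases "y = x")
    case False
    define t where "t = norm (y - x)"
    have t: "t > 0" "t < (1/2) ^ N" "t \<le> e / 4"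
      using False y by (auto simp: t_def d_def)
    obtain n0 where "(1/2) ^ n0 < t"
      using real_arch_pow_inv[of t "1/2"] t by auto
    then have least: "(1/2) ^ (LEAST n. (1/2) ^ n < t) < t"
      by (rule LeastI)
    \<comment> \<open>The scale to be used is the predecessor \<open>n\<close> of \<open>m\<close>,
      so m > N is what yields n \<ge> N.\<close>
    define m where "m = (LEAST n. (1/2) ^ n < t)"
    have m: "(1/2) ^ m < t"
      using least by (simp add: m_def)
    have "m > N"
    proof (rule ccontr)
      assume "\<not> m > N"
      then have "(1/2) ^ N \<le> ((1/2) ^ m :: real)"
        by (intro power_decreasing) auto
      with m t show False by linarith
    qed
    then obtain n where n: "m = Suc n" "n \<ge> N"
      by (cases m) auto
    have "t \<le> (1/2) ^ n"
      using not_less_Least[of n "\<lambda>n. (1/2) ^ n < t"] n by (simp add: m_def[symmetric] not_less)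
    then have "norm (f y - f x) \<le> (1/4) ^ n"
      using n y by (intro N) (auto simp: t_def)
    also have "(1/4) ^ n = 4 * ((1/2) ^ m * (1/2) ^ m :: real)"
      by (simp add: n power_mult_distrib[symmetric])
    also have "\<dots> \<le> 4 * (t * t)"
      using m t by (intro mult_left_mono mult_mono) auto
    also have "\<dots> \<le> e * t"
      using t by simp
    finally show ?thesis
      by (simp add: t_def)
  qed simp
  then show "\<exists>d>0. \<forall>y\<in>S. norm (y - x) < d \<longrightarrow> norm (f y - f x - 0) \<le> e * norm (y - x)"
    using e by (intro exI[of _ d]) (auto simp: d_def)
qed simp

text \<open>The constant is the bound of the derivative plus 1 for the remainder. This pointwise
  Lipschitz estimate is what the rough shear violates.\<close>

lemma differentiable_imp_locally_lipschitz_at: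
  fixes f :: "'a::real_normed_vector \<Rightarrow> 'b::real_normed_vector"
  assumes "f differentiable (at x within S)"
  obtains d C where "d > 0" "C > 0"
    "\<And>y. y \<in> S \<Longrightarrow> norm (y - x) < d \<Longrightarrow> norm (f y - f x) \<le> C * norm (y - x)"
proof -
  obtain f' where f': "(f has_derivative f') (at x within S)"
    using assms by (auto simp: differentiable_def)
  then obtain d where d: "d > 0"
    "\<And>y. y \<in> S \<Longrightarrow> norm (y - x) < d \<Longrightarrow> norm (f y - f x - f' (y - x)) \<le> 1 * norm (y - x)"
    unfolding has_derivative_within_alt using zero_less_one by blast
  obtain K where K: "K > 0" "\<And>z. norm (f' z) \<le> norm z * K"
    using bounded_linear.pos_bounded[OF has_derivative_bounded_linear[OF f']] by blast
  have "norm (f y - f x) \<le> (1 + K) * norm (y - x)" if "y \<in> S" "norm (y - x) < d" for y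
  proof -
    have "norm (f y - f x) \<le> norm (f y - f x - f' (y - x)) + norm (f' (y - x))"
      by (metis diff_add_cancel norm_triangle_ineq)
    then show ?thesis
      using d(2)[OF that] K(2)[of "y - x"] by (simp add: algebra_simps)
  qed
  with d(1) K(1) show thesis
    by (intro that[of d "1 + K"]) auto
qed

section \<open>Coordinatewise homeomorphisms and shears of the cube\<close>

lemma product_in_Homeo_unit_cube:
  fixes \<eta> :: "real \<Rightarrow> real"
  assumes "continuous_on UNIV \<eta>" "strict_mono \<eta>" "\<eta> 0 = 0" "\<eta> 1 = 1"
  shows "restrict (\<lambda>x. \<chi> i. \<eta> (x $ i)) unit_cube \<in> carrier (Homeo (unit_cube :: (real ^ 'n) set))"
proof (rule restrict_in_Homeo[OF compact_unit_cube])
  let ?h = "\<lambda>x :: real ^ 'n. \<chi> i. \<eta> (x $ i)"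
  show "continuous_on unit_cube ?h"
    by (intro continuous_on_vec_lambda continuous_on_compose2[OF assms(1)] continuous_intros) auto
  show "inj_on ?h unit_cube"
    using strict_mono_eq[OF assms(2)] by (auto simp: inj_on_def vec_eq_iff)
  have range: "\<eta> s \<in> {0..1}" if "s \<in> {0..1}" for s
    using strict_mono_less_eq[OF assms(2), of 0 s] strict_mono_less_eq[OF assms(2), of s 1] that assms
    by auto
  have onto: "\<exists>s\<in>{0..1}. \<eta> s = r" if "r \<in> {0..1}" for r
    using IVT'[of \<eta> 0 r 1] that assms continuous_on_subset by fastforce
  show "?h ` unit_cube = unit_cube"
  proof (intro equalityI subsetI)
    fix y :: "real ^ 'n" assume y: "y \<in> unit_cube"
    have "\<forall>i. \<exists>s\<in>{0..1}. \<eta> s = y $ i"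
      using y onto by (simp add: mem_unit_cube)
    then obtain x where x: "\<And>i. x i \<in> {0..1}" "\<And>i. \<eta> (x i) = y $ i"
      by metis
    then have "vec_lambda x \<in> unit_cube" "?h (vec_lambda x) = y"
      by (simp_all add: mem_unit_cube vec_eq_iff)
    then show "y \<in> ?h ` unit_cube"
      by blast
  qed (use range in \<open>auto simp: mem_unit_cube\<close>)
qed

definition shear :: "(real \<Rightarrow> real) \<Rightarrow> 'n \<Rightarrow> 'n \<Rightarrow> real ^ 'n \<Rightarrow> real ^ 'n" where
  "shear w i j x = (\<chi> l. if l = j then x $ j + w (x $ i) * (x $ j * (1 - x $ j)) else x $ l)"

text \<open>Since coordinate \<open>i\<close> is kept, everything reduces to t \<mapsto> t + c * t *
  (1 - t) on [0,1] with \<bar>c\<bar> \<le> 1/2. It fixes both endpoints, which gives surjectivity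
  by the intermediate value theorem, and its difference quotients 1 + c * (1 - t - s) are at least
  1/2.\<close>

lemma shear_in_Homeo_unit_cube:
  fixes w :: "real \<Rightarrow> real" and i j :: "'n::finite"
  assumes "continuous_on UNIV w" "\<And>s. \<bar>w s\<bar> \<le> 1/2" "i \<noteq> j"
  shows "restrict (shear w i j) unit_cube \<in> carrier (Homeo (unit_cube :: (real ^ 'n) set))"
proof (rule restrict_in_Homeo[OF compact_unit_cube])
  have range: "t + c * (t * (1 - t)) \<in> {0..1}" if "t \<in> {0..1}" "\<bar>c\<bar> \<le> 1/2" for c t :: real
  proof -
    have "t * (1 - t) \<le> t" "t * (1 - t) \<le> 1 - t" "0 \<le> t * (1 - t)"
      using that by (auto intro: mult_left_le mult_left_le_one_le)
    moreover have "\<bar>c * (t * (1 - t))\<bar> \<le> 1/2 * (t * (1 - t))"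
    proof -
      have "\<bar>c * (t * (1 - t))\<bar> = \<bar>c\<bar> * (t * (1 - t))"
        using \<open>0 \<le> t * (1 - t)\<close> by (subst abs_mult) (simp only: abs_of_nonneg)
      also have "\<dots> \<le> 1/2 * (t * (1 - t))"
        using that \<open>0 \<le> t * (1 - t)\<close> by (intro mult_right_mono)
      finally show ?thesis .
    qed
    ultimately show ?thesis
      unfolding atLeastAtMost_iff by linarith
  qed
  have inj: "t = s" if "t \<in> {0..1}" "s \<in> {0..1}" "\<bar>c\<bar> \<le> 1/2"
    "t + c * (t * (1 - t)) = s + c * (s * (1 - s))" for c s t :: real
  proof -
    have "(t - s) * (1 + c * (1 - t - s)) = 0"
      using that(4) by (simp add: algebra_simps)
    moreover have "\<bar>c * (1 - t - s)\<bar> \<le> 1/2 * 1"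
      unfolding abs_mult using that by (intro mult_mono) auto
    then have "1 + c * (1 - t - s) \<noteq> 0"
      by linarith
    ultimately show ?thesis by simp
  qed
  have onto: "\<exists>t\<in>{0..1}. t + c * (t * (1 - t)) = r" if "r \<in> {0..1}" for c r :: real
    using IVT'[of "\<lambda>t. t + c * (t * (1 - t))" 0 r 1] that by (fastforce intro!: continuous_intros)
  show "continuous_on unit_cube (shear w i j)"
  proof -
    have "continuous_on unit_cube (\<lambda>x :: real ^ 'n.
        if l = j then x $ j + w (x $ i) * (x $ j * (1 - x $ j)) else x $ l)" for l
      by (cases "l = j") (auto intro!: continuous_intros continuous_on_compose2[OF assms(1)])
    then show ?thesis
      unfolding shear_def by (intro continuous_on_vec_lambda)
  qed
  show "inj_on (shear w i j) unit_cube"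
  proof (rule inj_onI)
    fix x y :: "real ^ 'n" assume xy: "x \<in> unit_cube" "y \<in> unit_cube" "shear w i j x = shear w i j y"
    then have *: "(if l = j then x $ j + w (x $ i) * (x $ j * (1 - x $ j)) else x $ l)
      = (if l = j then y $ j + w (y $ i) * (y $ j * (1 - y $ j)) else y $ l)" for l
      by (simp add: shear_def vec_eq_iff)
    have eq: "x $ l = y $ l" if "l \<noteq> j" for l
      using *[of l] that by simp
    have "x $ j = y $ j"
    proof (rule inj)
      show "x $ j \<in> {0..1}" "y $ j \<in> {0..1}" "\<bar>w (x $ i)\<bar> \<le> 1/2"
        using xy(1,2) assms(2) unfolding mem_unit_cube by blast+
      show "x $ j + w (x $ i) * (x $ j * (1 - x $ j)) = y $ j + w (x $ i) * (y $ j * (1 - y $ j))"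
        using *[of j] unfolding eq[OF assms(3)] by simp
    qed
    with eq show "x = y"
      by (metis vec_eq_iff)
  qed
  show "shear w i j ` unit_cube = unit_cube"
  proof (intro equalityI subsetI)
    fix y :: "real ^ 'n" assume y: "y \<in> unit_cube"
    then obtain t where t: "t \<in> {0..1}" "t + w (y $ i) * (t * (1 - t)) = y $ j"
      using onto[of "y $ j" "w (y $ i)"] by (auto simp: mem_unit_cube)
    define x where "x = (\<chi> l. if l = j then t else y $ l)"
    have "x \<in> unit_cube"
      using y t by (auto simp: x_def mem_unit_cube)
    moreover have "shear w i j x = y"
      using t assms(3) by (auto simp: x_def shear_def vec_eq_iff)
    ultimately show "y \<in> shear w i j ` unit_cube"
      by blast
  next
    fix y assume "y \<in> shear w i j ` unit_cube"
    then obtain x where x: "x \<in> unit_cube" "y = shear w i j x"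
      by blast
    have "y $ l \<in> {0..1}" for l
      using x(1) range[of "x $ j" "w (x $ i)"] assms(2)
      by (cases "l = j") (simp_all add: x(2) mem_unit_cube shear_def)
    then show "y \<in> unit_cube"
      by (simp add: mem_unit_cube)
  qed
qed

section \<open>Catching equicontinuous families\<close>

lemma bimodulusD:
  assumes "f \<in> (\<Inter>n. bimodulus S n (m n))" "x \<in> S" "y \<in> S"
  shows "dist x y < 1 / Suc (m n) \<Longrightarrow> dist (f x) (f y) \<le> 1 / Suc n"
    and "dist (f x) (f y) < 1 / Suc (m n) \<Longrightarrow> dist x y \<le> 1 / Suc n"
  using assms unfolding bimodulus_def by blast+

lemma one_l_coset_Homeo:
  assumes "K \<subseteq> carrier (Homeo S)"
  shows "\<one>\<^bsub>Homeo S\<^esub> <#\<^bsub>Homeo S\<^esub> K = K"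
proof -
  interpret group "Homeo S" by (rule group_Homeo)
  show ?thesis
    using assms by (force simp: l_coset_def)
qed

text \<open>A flat coordinatewise \<open>h\<close> sends the 2^-n ball around almost every point
  into a set so small that the common modulus of the maps \<open>k\<close> keeps its image within
  4^-n; the dyadic criterion then gives derivative 0.\<close>

lemma strongly_singular_translate:
  fixes m :: "nat \<Rightarrow> nat"
  shows "\<exists>h\<in>carrier (Homeo (unit_cube :: (real ^ 'n) set)).
    \<forall>k\<in>(\<Inter>n. bimodulus unit_cube n (m n)). strongly_singular (k \<otimes>\<^bsub>Homeo unit_cube\<^esub> h)"
proof -
  \<comment> \<open>\<open>m (4 ^ n)\<close> is the modulus for tolerance 1/(4^n + 1). The dimension
    in the denominator pays for summing over coordinates, and the 2 makes the final inequality
    strict.\<close>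
  define \<delta> where "\<delta> n = 1 / real (Suc (m (4 ^ n))) / (2 * real CARD('n))" for n
  have \<delta>: "\<delta> n > 0" for n
    by (simp add: \<delta>_def)
  have half: "z > 0 \<Longrightarrow> z / 2 < z" for z :: real
    by simp
  obtain \<eta> :: "real \<Rightarrow> real" where \<eta>: "continuous_on UNIV \<eta>" "strict_mono \<eta>" "\<eta> 0 = 0" "\<eta> 1 = 1"
    and AE: "AE x in lebesgue. \<forall>\<^sub>F n in sequentially. \<forall>y. \<bar>y - x\<bar> \<le> (1/2) ^ n \<longrightarrow> \<bar>\<eta> y - \<eta> x\<bar> < \<delta> n"
    by (rule exists_flat_increasing_function[of \<delta>, OF \<delta>])
  define h where "h = restrict (\<lambda>x :: real ^ 'n. \<chi> i. \<eta> (x $ i)) unit_cube"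
  have h: "h \<in> carrier (Homeo unit_cube)"
    unfolding h_def by (rule product_in_Homeo_unit_cube[OF \<eta>])
  define B where "B = {x. \<not> (\<forall>\<^sub>F n in sequentially. \<forall>y. \<bar>y - x\<bar> \<le> (1/2) ^ n \<longrightarrow> \<bar>\<eta> y - \<eta> x\<bar> < \<delta> n)}"
  have "negligible B"
    using AE by (simp add: B_def completion.AE_iff_null_sets negligible_iff_null_sets del: not_eventually)
  \<comment> \<open>A point is bad as soon as one of its coordinates is bad for
    \<open>\<eta>\<close>.\<close>
  define N :: "(real ^ 'n) set" where "N = (\<Union>i. {x \<in> interior unit_cube. x $ i \<in> B})"
  have "negligible N"
    unfolding N_def using negligible_component_vimage[OF \<open>negligible B\<close>] by (intro negligible_Union) auto
  show ?thesis
  proof (intro bexI[OF _ h] ballI)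
    fix k :: "real ^ 'n \<Rightarrow> real ^ 'n" assume k: "k \<in> (\<Inter>n. bimodulus unit_cube n (m n))"
    then have kc: "k \<in> carrier (Homeo unit_cube)"
      by (auto simp: bimodulus_def)
    have kh: "(k \<otimes>\<^bsub>Homeo unit_cube\<^esub> h) x = k (h x)" if "x \<in> unit_cube" for x
      using that by (simp add: mult_Homeo[OF kc h] compose_def)
    show "strongly_singular (k \<otimes>\<^bsub>Homeo unit_cube\<^esub> h)"
    proof (rule strongly_singularI[OF \<open>negligible N\<close>], rule has_derivative_0_if_dyadic_decay)
      fix x :: "real ^ 'n" assume x: "x \<in> interior unit_cube" "x \<notin> N"
      then have x': "x \<in> unit_cube"
        using interior_subset by blast
      have "\<forall>i. \<forall>\<^sub>F n in sequentially. \<forall>y. \<bar>y - x $ i\<bar> \<le> (1/2) ^ n \<longrightarrow> \<bar>\<eta> y - \<eta> (x $ i)\<bar> < \<delta> n"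
        using x unfolding N_def B_def by blast
      then have "\<forall>\<^sub>F n in sequentially. \<forall>i. \<forall>y. \<bar>y - x $ i\<bar> \<le> (1/2) ^ n \<longrightarrow> \<bar>\<eta> y - \<eta> (x $ i)\<bar> < \<delta> n"
        by (simp add: eventually_all_finite)
      then show "\<forall>\<^sub>F n in sequentially. \<forall>y\<in>unit_cube. norm (y - x) \<le> (1/2) ^ n \<longrightarrow>
        norm ((k \<otimes>\<^bsub>Homeo unit_cube\<^esub> h) y - (k \<otimes>\<^bsub>Homeo unit_cube\<^esub> h) x) \<le> (1/4) ^ n"
      proof (eventually_elim, intro ballI impI)
        fix n and y :: "real ^ 'n"
        assume n: "\<forall>i. \<forall>y. \<bar>y - x $ i\<bar> \<le> (1/2) ^ n \<longrightarrow> \<bar>\<eta> y - \<eta> (x $ i)\<bar> < \<delta> n"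
          and y: "y \<in> unit_cube" "norm (y - x) \<le> (1/2) ^ n"
        have comp: "\<bar>(h y - h x) $ i\<bar> \<le> \<delta> n" for i
        proof -
          have "\<bar>y $ i - x $ i\<bar> \<le> (1/2) ^ n"
            using component_le_norm_cart[of "y - x" i] y by simp
          then show ?thesis
            using n y x' by (simp add: h_def less_imp_le)
        qed
        have "norm (h y - h x) \<le> (\<Sum>i\<in>UNIV. \<bar>(h y - h x) $ i\<bar>)"
          by (rule norm_le_l1_cart)
        also have "\<dots> \<le> (\<Sum>i\<in>(UNIV :: 'n set). \<delta> n)"
          by (intro sum_mono comp)
        also have "\<dots> = 1 / real (Suc (m (4 ^ n))) / 2"
          by (simp add: \<delta>_def)
        also have "\<dots> < 1 / real (Suc (m (4 ^ n)))"
          using half[of "1 / real (Suc (m (4 ^ n)))"] by simp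
        finally have "dist (h y) (h x) < 1 / Suc (m (4 ^ n))"
          by (simp add: dist_norm)
        then have "dist (k (h y)) (k (h x)) \<le> 1 / Suc (4 ^ n)"
          using y x' h by (intro bimodulusD(1)[OF k]) (auto intro: Homeo_in)
        also have "\<dots> \<le> 1 / 4 ^ n"
          by (rule divide_left_mono) (auto intro!: mult_pos_pos add_pos_pos)
        also have "\<dots> = (1/4) ^ n"
          by (simp add: power_one_over)
        finally show "norm ((k \<otimes>\<^bsub>Homeo unit_cube\<^esub> h) y - (k \<otimes>\<^bsub>Homeo unit_cube\<^esub> h) x) \<le> (1/4) ^ n"
          using y x' by (simp add: kh dist_norm)
      qed
    qed
  qed
qed

text \<open>Near any interior \<open>x\<close> there are points \<open>y\<close> within 64^-n for
  which the j-th coordinate of the image under g after k moves by at least a constant times 8^-n.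
  The quotients grow like 8^n, contradicting differentiability.\<close>

lemma not_strongly_singular_translate:
  fixes m :: "nat \<Rightarrow> nat"
  assumes "CARD('n) \<ge> 2"
  shows "\<exists>g\<in>carrier (Homeo (unit_cube :: (real ^ 'n) set)).
    \<forall>k\<in>(\<Inter>n. bimodulus unit_cube n (m n)). \<not> strongly_singular (g \<otimes>\<^bsub>Homeo unit_cube\<^esub> k)"
proof -
  obtain i j :: 'n where ij: "i \<noteq> j"
    using assms card_le_Suc0_iff_eq[of "UNIV :: 'n set"] by auto
  have pos: "1 / real (Suc (m (64 ^ n))) > 0" for n
    by simp
  obtain w :: "real \<Rightarrow> real" where w: "continuous_on UNIV w" "\<And>s. \<bar>w s\<bar> \<le> 1/2"
    and rough: "\<And>n s. s \<in> {0..1} \<Longrightarrow>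
      \<exists>s'\<in>{0..1}. \<bar>s' - s\<bar> < 1 / Suc (m (64 ^ n)) \<and> \<bar>w s' - w s\<bar> \<ge> (1/8) ^ (n + 2)"
    by (rule exists_rough_function[of "\<lambda>n. 1 / real (Suc (m (64 ^ n)))", OF pos]) blast
  define g where "g = restrict (shear w i j) unit_cube"
  have g: "g \<in> carrier (Homeo unit_cube)"
    unfolding g_def by (rule shear_in_Homeo_unit_cube[OF w ij])
  show ?thesis
  proof (intro bexI[OF _ g] ballI, rule not_strongly_singularI, rule notI)
    fix k and x :: "real ^ 'n"
    assume k: "k \<in> (\<Inter>n. bimodulus unit_cube n (m n))" and x: "x \<in> interior unit_cube"
      and diff: "(g \<otimes>\<^bsub>Homeo unit_cube\<^esub> k) differentiable (at x within unit_cube)"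
    have kc: "k \<in> carrier (Homeo unit_cube)"
      using k by (auto simp: bimodulus_def)
    then obtain k' where k': "homeomorphism unit_cube unit_cube k k'"
      by (auto simp: carrier_Homeo)
    have x': "x \<in> unit_cube"
      using x interior_subset by blast
    have gk: "(g \<otimes>\<^bsub>Homeo unit_cube\<^esub> k) y = shear w i j (k y)" if "y \<in> unit_cube" for y
      unfolding mult_Homeo[OF g kc] using that Homeo_in[OF kc that] by (simp add: compose_def g_def)
    \<comment> \<open>Invariance of domain keeps \<open>k x\<close> off the boundary, so the factor
      \<open>c\<close> multiplying the rough function is positive.\<close>
    have "open (k ` interior unit_cube)"
    proof (rule invariance_of_domain)
      show "continuous_on (interior unit_cube) k"
        by (rule continuous_on_subset[OF homeomorphism_cont1[OF k'] interior_subset])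
      show "inj_on k (interior unit_cube)"
        using homeomorphism_apply1[OF k'] interior_subset by (intro inj_on_inverseI[of _ k']) blast
    qed simp
    moreover have "k ` interior unit_cube \<subseteq> unit_cube"
      using Homeo_in[OF kc] interior_subset by blast
    ultimately have "k x \<in> interior unit_cube"
      using x interior_maximal by blast
    then have u: "0 < k x $ l" "k x $ l < 1" for l
      by (auto simp: interior_unit_cube)
    define c where "c = k x $ j * (1 - k x $ j)"
    have "c > 0"
      using u[of j] by (simp add: c_def)
    obtain d C where d: "d > 0" and "C > 0" and C: "\<And>y. y \<in> unit_cube \<Longrightarrow> norm (y - x) < d \<Longrightarrow>
        norm ((g \<otimes>\<^bsub>Homeo unit_cube\<^esub> k) y - (g \<otimes>\<^bsub>Homeo unit_cube\<^esub> k) x) \<le> C * norm (y - x)"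
      by (rule differentiable_imp_locally_lipschitz_at[OF diff]) blast
    have bound: "8 ^ n \<le> 64 * C / c" if n: "1 / 64 ^ n < d" for n
    proof -
      have "k x $ i \<in> {0..1}"
        using u[of i] by (simp add: less_imp_le)
      from rough[OF this, of n] obtain s' where s': "s' \<in> {0..1}" "\<bar>s' - k x $ i\<bar> < 1 / Suc (m (64 ^ n))"
        "\<bar>w s' - w (k x $ i)\<bar> \<ge> (1/8) ^ (n + 2)"
        by blast
      \<comment> \<open>Only coordinate \<open>i\<close> of \<open>k x\<close> is changed. As i
        \<noteq> j, the j-th coordinate of the shear changes exactly by the oscillation of
        \<open>w\<close> times \<open>c\<close>.\<close>
      define v where "v = (\<chi> l. if l = i then s' else k x $ l)"
      have v: "v \<in> unit_cube"
        using s' u by (auto simp: v_def mem_unit_cube less_imp_le)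
      define y where "y = k' v"
      have y: "y \<in> unit_cube" "k y = v"
        using v k' by (auto simp: y_def homeomorphism_def)
      have "norm (v - k x) \<le> (\<Sum>l\<in>UNIV. \<bar>(v - k x) $ l\<bar>)"
        by (rule norm_le_l1_cart)
      also have "\<dots> = (\<Sum>l\<in>UNIV. if l = i then \<bar>s' - k x $ i\<bar> else 0)"
        by (intro sum.cong) (auto simp: v_def)
      finally have "norm (v - k x) \<le> \<bar>s' - k x $ i\<bar>"
        by simp
      then have "dist (k y) (k x) < 1 / Suc (m (64 ^ n))"
        using s'(2) unfolding y dist_norm by linarith
      then have "dist y x \<le> 1 / Suc (64 ^ n)"
        by (rule bimodulusD(2)[OF k y(1) x'])
      also have "\<dots> \<le> 1 / 64 ^ n"
        by (rule divide_left_mono) (auto intro!: mult_pos_pos add_pos_pos)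
      finally have yx: "norm (y - x) \<le> 1 / 64 ^ n"
        by (simp add: dist_norm)
      have "(1/8) ^ (n + 2) * c \<le> \<bar>w s' - w (k x $ i)\<bar> * c"
        using s' \<open>c > 0\<close> by (intro mult_right_mono) auto
      also have "\<dots> = \<bar>(shear w i j v - shear w i j (k x)) $ j\<bar>"
        using \<open>c > 0\<close> ij by (simp add: shear_def v_def c_def[symmetric] left_diff_distrib[symmetric] abs_mult)
      also have "\<dots> \<le> norm (shear w i j v - shear w i j (k x))"
        by (rule component_le_norm_cart)
      also have "\<dots> \<le> C * norm (y - x)"
        using C[OF y(1)] yx n gk[OF y(1)] gk[OF x'] y(2) by simp
      also have "\<dots> \<le> C * (1 / 64 ^ n)"
        using yx \<open>C > 0\<close> by (intro mult_left_mono) auto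
      finally have "(1/8) ^ (n + 2) * c * 64 ^ n \<le> C"
        by (simp add: field_simps)
      moreover have "(1/8) ^ (n + 2) * c * 64 ^ n = 8 ^ n * c / (64 :: real)"
      proof -
        have "(64 :: real) ^ n = 8 ^ n * 8 ^ n"
          by (simp add: power_mult_distrib[symmetric])
        then show ?thesis
          by (simp add: power_add power_one_over)
      qed
      ultimately show ?thesis
        using \<open>c > 0\<close> by (simp add: field_simps)
    qed
    obtain n1 where n1: "(1/64) ^ n1 < d"
      using real_arch_pow_inv[OF d, of "1/64"] by auto
    obtain n2 where n2: "64 * C / c < 8 ^ n2"
      using real_arch_pow[of 8 "64 * C / c"] by auto
    \<comment> \<open>At the larger index the scale is below \<open>d\<close>, so
      \<open>bound\<close> applies, while 8^n already exceeds its right-hand side.\<close>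
    have "(1/64) ^ max n1 n2 \<le> ((1/64) ^ n1 :: real)" "8 ^ n2 \<le> (8 ^ max n1 n2 :: real)"
      by (auto intro: power_decreasing power_increasing)
    moreover have "1 / 64 ^ max n1 n2 = ((1/64) ^ max n1 n2 :: real)"
      by (simp add: power_one_over)
    ultimately show False
      using n1 n2 bound[of "max n1 n2"] by linarith
  qed
qed

theorem theorem5p1:
  fixes \<F> :: "(real ^ 'n \<Rightarrow> real ^ 'n) set"
  defines "\<F> \<equiv> {f \<in> carrier (Homeo unit_cube). strongly_singular f}"
  assumes "CARD('n) \<ge> 2"
  shows "haar_ambivalent (Homeo unit_cube) (homeo_topology unit_cube) \<F>
    \<and> compact_catcher (Homeo unit_cube) (homeo_topology unit_cube) \<F>
    \<and> compact_catcher (Homeo unit_cube) (homeo_topology unit_cube)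
        (carrier (Homeo unit_cube) - \<F>)"
proof -
  let ?G = "Homeo (unit_cube :: (real ^ 'n) set)"
  interpret group ?G by (rule group_Homeo)
  have K: "(\<Inter>n. bimodulus unit_cube n (m n)) \<subseteq> carrier ?G" for m
    by (auto simp: bimodulus_def)
  \<comment> \<open>Right translation by \<open>h\<close> suffices; the left factor is the
    identity.\<close>
  have catch: "\<exists>g\<in>carrier ?G. \<exists>h\<in>carrier ?G.
      (g <#\<^bsub>?G\<^esub> (\<Inter>n. bimodulus unit_cube n (m n))) #>\<^bsub>?G\<^esub> h \<subseteq> \<F>" for m
  proof -
    obtain h where h: "h \<in> carrier ?G"
      "\<And>k. k \<in> (\<Inter>n. bimodulus unit_cube n (m n)) \<Longrightarrow> strongly_singular (k \<otimes>\<^bsub>?G\<^esub> h)"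
      using strongly_singular_translate[of m] by blast
    have "(\<Inter>n. bimodulus unit_cube n (m n)) #>\<^bsub>?G\<^esub> h \<subseteq> \<F>"
    proof
      fix f assume "f \<in> (\<Inter>n. bimodulus unit_cube n (m n)) #>\<^bsub>?G\<^esub> h"
      then obtain k where k: "k \<in> (\<Inter>n. bimodulus unit_cube n (m n))" "f = k \<otimes>\<^bsub>?G\<^esub> h"
        unfolding r_coset_def by blast
      then show "f \<in> \<F>"
        using h K[of m] unfolding \<F>_def by blast
    qed
    then show ?thesis
      using h(1) one_l_coset_Homeo[OF K] by (intro bexI[of _ "\<one>\<^bsub>?G\<^esub>"] bexI[of _ h]) auto
  qed
  \<comment> \<open>Here the left translation does the work and the right factor is the identity.
    Catching by the complement is also what excludes prevalence.\<close>
  have catch_compl: "\<exists>g\<in>carrier ?G. \<exists>h\<in>carrier ?G.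
      (g <#\<^bsub>?G\<^esub> (\<Inter>n. bimodulus unit_cube n (m n))) #>\<^bsub>?G\<^esub> h \<subseteq> carrier ?G - \<F>" for m
  proof -
    obtain g where g: "g \<in> carrier ?G"
      "\<And>k. k \<in> (\<Inter>n. bimodulus unit_cube n (m n)) \<Longrightarrow> \<not> strongly_singular (g \<otimes>\<^bsub>?G\<^esub> k)"
      using not_strongly_singular_translate[OF assms(2), of m] by blast
    have "(g <#\<^bsub>?G\<^esub> (\<Inter>n. bimodulus unit_cube n (m n))) #>\<^bsub>?G\<^esub> \<one>\<^bsub>?G\<^esub> \<subseteq> carrier ?G - \<F>"
    proof
      fix f assume "f \<in> (g <#\<^bsub>?G\<^esub> (\<Inter>n. bimodulus unit_cube n (m n))) #>\<^bsub>?G\<^esub> \<one>\<^bsub>?G\<^esub>"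
      then obtain k where k: "k \<in> (\<Inter>n. bimodulus unit_cube n (m n))"
        "f = g \<otimes>\<^bsub>?G\<^esub> k \<otimes>\<^bsub>?G\<^esub> \<one>\<^bsub>?G\<^esub>"
        unfolding r_coset_def l_coset_def by blast
      then have "k \<in> carrier ?G"
        using K by blast
      then have "f = g \<otimes>\<^bsub>?G\<^esub> k" "f \<in> carrier ?G"
        using k(2) g(1) by simp_all
      then show "f \<in> carrier ?G - \<F>"
        using g(2)[OF k(1)] unfolding \<F>_def by blast
    qed
    then show ?thesis
      using g(1) by blast
  qed
  have sub: "\<F> \<subseteq> carrier ?G"
    by (auto simp: \<F>_def)
  show ?thesis
    unfolding haar_ambivalent_def prevalent_def
    using sub not_haar_nullI[OF compact_unit_cube catch] not_haar_nullI[OF compact_unit_cube catch_compl]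
      compact_catcherI[OF compact_unit_cube sub catch]
      compact_catcherI[OF compact_unit_cube _ catch_compl]
    by blast
qed

end
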